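(* Let $\{\Lambda_t\}_{t\ge0}$ be a dynamical map on $M_d(\mathbb{C})$ with every $\Lambda_t$ invertible, and set $V_{t,s}:=\Lambda_t\Lambda_s^{-1}$ for $t\ge s\ge0$. The following are equivalent: (1) $\{\Lambda_t\}$ is divisible, i.e. $V_{t,s}$ is completely positive for all $t\ge s\ge0$; (2) $\|V_{t,s}\|_\diamond=1$ for all $t\ge s\ge 0$; (3) for every Hermitian $W\in M_d(\mathbb{C})\otimes M_d(\mathbb{C})$, the function $t\mapsto\|(\mathrm{id}\otimes\Lambda_t)W\|_1$ is nonincreasing on $[0,\infty)$.
   Context: A dynamical map is a family $\{\Lambda_t\}_{t\ge0}$ of completely positive trace-preserving linear maps on $M_d(\mathbb{C})$ with $\Lambda_0=\mathrm{id}$. $\|\cdot\|_1$ is the trace norm. For a linear map $\Lambda$ on $M_d(\mathbb{C})$, the diamond norm is $\|\Lambda\|_\diamond:=\sup\{\|(\mathrm{id}\otimes\Lambda)W\|_1: W\in M_d(\mathbb{C})\otimes M_d(\mathbb{C}),\ \|W\|_1=1\}$, where $\mathrm{id}$ is the identity map on $M_d(\mathbb{C})$. *)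

theory Defs
  imports "Jordan_Normal_Form.Matrix"
begin

text \<open>Matrices in M_d(C) are JNF matrices in carrier_mat d d.
  M_n(C) tensor M_d(C) is identified with carrier_mat (n*d) (n*d), the entry
  of E_ij tensor B at row i*d+k, column j*d+l being B at (k,l).\<close>

definition adj :: "complex mat \<Rightarrow> complex mat" where
  "adj A = mat (dim_col A) (dim_row A) (\<lambda>(i,j). cnj (A $$ (j,i)))"

definition mtrace :: "complex mat \<Rightarrow> complex" where
  "mtrace A = (\<Sum>i<dim_row A. A $$ (i,i))"

definition hermitian_mat :: "complex mat \<Rightarrow> bool" where
  "hermitian_mat A \<longleftrightarrow> A \<in> carrier_mat (dim_row A) (dim_row A) \<and> adj A = A"

definition psd :: "complex mat \<Rightarrow> bool" where
  "psd A \<longleftrightarrow> hermitian_mat A \<and>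
     (\<forall>v \<in> carrier_vec (dim_row A). 0 \<le> Re ((A *\<^sub>v v) \<bullet>c v))"

definition trace_norm :: "complex mat \<Rightarrow> real" where
  "trace_norm A = Re (mtrace (THE P. psd P \<and> P * P = adj A * A))"

text \<open>(id_n tensor Lambda) W for W in M_n tensor M_d, computed blockwise.\<close>
definition ampl :: "nat \<Rightarrow> nat \<Rightarrow> (complex mat \<Rightarrow> complex mat) \<Rightarrow> complex mat \<Rightarrow> complex mat" where
  "ampl n d \<Lambda> W = mat (n*d) (n*d) (\<lambda>(a,b).
      \<Lambda> (mat d d (\<lambda>(k,l). W $$ ((a div d)*d+k, (b div d)*d+l))) $$ (a mod d, b mod d))"

definition linear_map_on :: "nat \<Rightarrow> (complex mat \<Rightarrow> complex mat) \<Rightarrow> bool" where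
  "linear_map_on d \<Lambda> \<longleftrightarrow>
     (\<forall>A \<in> carrier_mat d d. \<Lambda> A \<in> carrier_mat d d) \<and>
     (\<forall>A \<in> carrier_mat d d. \<forall>B \<in> carrier_mat d d. \<Lambda> (A + B) = \<Lambda> A + \<Lambda> B) \<and>
     (\<forall>c. \<forall>A \<in> carrier_mat d d. \<Lambda> (c \<cdot>\<^sub>m A) = c \<cdot>\<^sub>m \<Lambda> A)"

definition completely_positive :: "nat \<Rightarrow> (complex mat \<Rightarrow> complex mat) \<Rightarrow> bool" where
  "completely_positive d \<Lambda> \<longleftrightarrow>
     (\<forall>n. \<forall>W \<in> carrier_mat (n*d) (n*d). psd W \<longrightarrow> psd (ampl n d \<Lambda> W))"

definition trace_preserving :: "nat \<Rightarrow> (complex mat \<Rightarrow> complex mat) \<Rightarrow> bool" where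
  "trace_preserving d \<Lambda> \<longleftrightarrow> (\<forall>A \<in> carrier_mat d d. mtrace (\<Lambda> A) = mtrace A)"

definition cptp :: "nat \<Rightarrow> (complex mat \<Rightarrow> complex mat) \<Rightarrow> bool" where
  "cptp d \<Lambda> \<longleftrightarrow> linear_map_on d \<Lambda> \<and> completely_positive d \<Lambda> \<and> trace_preserving d \<Lambda>"

definition dynamical_map :: "nat \<Rightarrow> (real \<Rightarrow> complex mat \<Rightarrow> complex mat) \<Rightarrow> bool" where
  "dynamical_map d \<Lambda> \<longleftrightarrow> (\<forall>t \<ge> 0. cptp d (\<Lambda> t)) \<and> (\<forall>A \<in> carrier_mat d d. \<Lambda> 0 A = A)"

definition diamond_norm :: "nat \<Rightarrow> (complex mat \<Rightarrow> complex mat) \<Rightarrow> real" where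
  "diamond_norm d \<Lambda> = Sup {trace_norm (ampl d d \<Lambda> W) | W.
      W \<in> carrier_mat (d*d) (d*d) \<and> trace_norm W = 1}"

definition prop_map :: "nat \<Rightarrow> (real \<Rightarrow> complex mat \<Rightarrow> complex mat) \<Rightarrow> real \<Rightarrow> real \<Rightarrow> complex mat \<Rightarrow> complex mat" where
  "prop_map d \<Lambda> t s = \<Lambda> t \<circ> inv_into (carrier_mat d d) (\<Lambda> s)"

end

theory Submission
  imports Defs "Jordan_Normal_Form.Spectral_Radius"
begin

text \<open>
  Write \<open>W = U P\<close> for the polar decomposition, \<open>P = |W|\<close>, with \<open>U\<close> a partial isometry. The block matrix with
  diagonal \<open>U P U\<^sup>*, P\<close> and off-diagonal entry \<open>W\<close> is positive, both diagonal blocks having trace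
  \<open>\<parallel>W\<parallel>\<^sub>1\<close>. A completely positive trace-preserving map sends it to a positive block matrix with
  the same traces, and the trace norm of the off-diagonal entry of a positive block matrix is at most the mean
  of the traces of the diagonal blocks; hence such a map contracts the trace norm.

  Conversely, a trace-preserving map that does not increase the trace norm of the maximally entangled state
  sends it to a matrix \<open>X\<close> with \<open>\<parallel>X\<parallel>\<^sub>1 \<le> Re (tr X)\<close>. With \<open>X = U P\<close> and \<open>S = P\<^sup>1\<^sup>/\<^sup>2\<close> the Frobenius norm
  of \<open>U S - S\<close> vanishes, so \<open>X = P\<close> is positive. This is the Choi matrix up to a factor, so the map is
  completely positive. For condition (3) one uses \<open>W = (id \<otimes> \<Lambda>\<^sub>s\<^sup>-\<^sup>1)\<close> of the maximally entangled
  state, which is Hermitian because \<open>\<Lambda>\<^sub>s\<close> preserves adjoints and is injective.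
\<close>

section \<open>Adjoints, traces and positive semidefinite matrices\<close>

lemma adj_dim [simp]: "dim_row (adj A) = dim_col A" "dim_col (adj A) = dim_row A"
  by (auto simp: adj_def)

lemma adj_index [simp]: "i < dim_col A \<Longrightarrow> j < dim_row A \<Longrightarrow> adj A $$ (i,j) = cnj (A $$ (j,i))"
  by (auto simp: adj_def)

lemma adj_carrier [simp]: "A \<in> carrier_mat n m \<Longrightarrow> adj A \<in> carrier_mat m n"
  by (auto simp: adj_def)

lemma adj_adj [simp]: "adj (adj A) = A"
  by (rule eq_matI) auto

lemma adj_one [simp]: "adj (1\<^sub>m n) = 1\<^sub>m n"
  by (rule eq_matI) auto

lemma adj_zero [simp]: "adj (0\<^sub>m n m) = 0\<^sub>m m n"
  by (rule eq_matI) auto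

lemma index_mult_mat_sum:
  assumes "A \<in> carrier_mat n m" "B \<in> carrier_mat m k" "i < n" "j < k"
  shows "(A * B) $$ (i,j) = (\<Sum>l<m. A $$ (i,l) * B $$ (l,j))"
  using assms by (auto simp: scalar_prod_def atLeast0LessThan intro!: sum.cong)

lemma adj_mult:
  assumes "A \<in> carrier_mat n m" "B \<in> carrier_mat m k"
  shows "adj (A * B) = adj B * adj A"
proof (rule eq_matI)
  fix i j assume "i < dim_row (adj B * adj A)" "j < dim_col (adj B * adj A)"
  then have "i < k" "j < n" using assms by auto
  then show "adj (A * B) $$ (i,j) = (adj B * adj A) $$ (i,j)"
    using assms index_mult_mat_sum[OF assms, of j i]
      index_mult_mat_sum[OF adj_carrier[OF assms(2)] adj_carrier[OF assms(1)], of i j]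
    by (auto simp: mult.commute simp del: index_mult_mat(1) intro!: sum.cong)
qed (use assms in auto)

text \<open>The side conditions mention only dimensions, so the simplifier can discharge them and
  reassociate long products; carrier premises would contain sizes that matching does not determine.
  \<open>mult_mat_distrib\<close> has its form for the same reason.\<close>

lemma mult_mat_assoc:
  fixes A B C :: "complex mat"
  assumes "dim_col A = dim_row B" "dim_col B = dim_row C"
  shows "A * B * C = A * (B * C)"
  using assms by (intro assoc_mult_mat[of _ "dim_row A" "dim_col A" _ "dim_col B" _ "dim_col C"]) auto

lemma mult_mat_distrib:
  fixes A B C :: "complex mat"
  assumes "dim_row B = dim_row C" "dim_col B = dim_col C"
  shows "dim_col A = dim_row B \<Longrightarrow> A * (B + C) = A * B + A * C"
    and "dim_col A = dim_row B \<Longrightarrow> A * (B - C) = A * B - A * C"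
    and "dim_row A = dim_col B \<Longrightarrow> (B + C) * A = B * A + C * A"
    and "dim_row A = dim_col B \<Longrightarrow> (B - C) * A = B * A - C * A"
proof -
  have BC: "B \<in> carrier_mat (dim_row B) (dim_col B)" "C \<in> carrier_mat (dim_row B) (dim_col B)"
    using assms by (auto intro!: carrier_matI)
  show "A * (B + C) = A * B + A * C" "A * (B - C) = A * B - A * C" if "dim_col A = dim_row B"
    using mult_add_distrib_mat[OF carrier_matI[OF refl that] BC]
      mult_minus_distrib_mat[OF carrier_matI[OF refl that] BC] by simp_all
  show "(B + C) * A = B * A + C * A" "(B - C) * A = B * A - C * A" if "dim_row A = dim_col B"
    using add_mult_distrib_mat[OF BC carrier_matI[OF that refl]]
      minus_mult_distrib_mat[OF BC carrier_matI[OF that refl]] by simp_all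
qed

lemma adj_congruence:
  assumes "A \<in> carrier_mat n n" "B \<in> carrier_mat n m"
  shows "adj (adj B * A * B) = adj B * adj A * B"
proof -
  have "adj (adj B * A * B) = adj B * adj (adj B * A)"
    using assms by (intro adj_mult[of _ m n]) auto
  also have "adj (adj B * A) = adj A * B"
    using assms adj_mult[of "adj B" m n A n] by simp
  finally show ?thesis using assms by (simp add: mult_mat_assoc)
qed

lemma adj_minus:
  assumes "A \<in> carrier_mat n m" "B \<in> carrier_mat n m"
  shows "adj (A - B) = adj A - adj B"
  using assms by (intro eq_matI) auto

lemma adj_uminus: "adj (- A) = - adj A"
  by (rule eq_matI) auto

lemma adj_four_block_mat:
  assumes "A \<in> carrier_mat n m" "B \<in> carrier_mat n m'" "C \<in> carrier_mat n' m" "D \<in> carrier_mat n' m'"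
  shows "adj (four_block_mat A B C D) = four_block_mat (adj A) (adj C) (adj B) (adj D)"
  using assms by (intro eq_matI) auto

section \<open>Trace identities and the Frobenius norm\<close>

lemma mtrace_carrier: "A \<in> carrier_mat n n \<Longrightarrow> mtrace A = (\<Sum>i<n. A $$ (i,i))"
  by (auto simp: mtrace_def)

lemma mtrace_mult_comm:
  assumes "A \<in> carrier_mat n m" "B \<in> carrier_mat m n"
  shows "mtrace (A * B) = mtrace (B * A)"
proof -
  have "mtrace (A * B) = (\<Sum>i<n. \<Sum>l<m. A $$ (i,l) * B $$ (l,i))"
    using mtrace_carrier[OF mult_carrier_mat[OF assms]] assms by (simp add: index_mult_mat_sum[OF assms] del: index_mult_mat(1))
  also have "\<dots> = (\<Sum>l<m. \<Sum>i<n. B $$ (l,i) * A $$ (i,l))"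
    by (subst sum.swap) (simp add: mult.commute)
  also have "\<dots> = mtrace (B * A)"
    using mtrace_carrier[OF mult_carrier_mat[OF assms(2,1)]] assms by (simp add: index_mult_mat_sum[OF assms(2,1)] del: index_mult_mat(1))
  finally show ?thesis .
qed

lemma mtrace_add:
  assumes "A \<in> carrier_mat n n" "B \<in> carrier_mat n n"
  shows "mtrace (A + B) = mtrace A + mtrace B"
  using assms by (auto simp: mtrace_def sum.distrib)

lemma mtrace_minus:
  assumes "A \<in> carrier_mat n n" "B \<in> carrier_mat n n"
  shows "mtrace (A - B) = mtrace A - mtrace B"
  using assms by (auto simp: mtrace_def sum_subtractf)

lemma mtrace_adj: "A \<in> carrier_mat n n \<Longrightarrow> mtrace (adj A) = cnj (mtrace A)"
  by (auto simp: mtrace_def intro!: sum.cong)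

lemma sum_lessThan_add:
  fixes f :: "nat \<Rightarrow> 'a::comm_monoid_add"
  shows "(\<Sum>i<n+m. f i) = (\<Sum>i<n. f i) + (\<Sum>i<m. f (n+i))"
  by (induction m) (auto simp: add.assoc)

lemma mtrace_four_block_mat:
  assumes "A \<in> carrier_mat n n" "D \<in> carrier_mat n n"
  shows "mtrace (four_block_mat A B C D) = mtrace A + mtrace D"
  using assms by (auto simp: mtrace_def sum_lessThan_add)

lemma mtrace_adj_mult_self:
  assumes "A \<in> carrier_mat n m"
  shows "mtrace (adj A * A) = complex_of_real (\<Sum>i<m. \<Sum>l<n. (cmod (A $$ (l,i)))\<^sup>2)"
proof -
  have *: "adj A \<in> carrier_mat m n" using assms by auto
  have "mtrace (adj A * A) = (\<Sum>i<m. \<Sum>l<n. cnj (A $$ (l,i)) * A $$ (l,i))"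
    using mtrace_carrier[OF mult_carrier_mat[OF * assms]] assms by (simp add: index_mult_mat_sum[OF * assms] del: index_mult_mat(1))
  then show ?thesis
    by (simp only: of_real_sum complex_norm_square mult.commute[of "cnj _"])
qed

text \<open>The trace is the squared Frobenius norm, a sum of squared moduli of all entries. This is
  the device by which matrix identities are later deduced from traces.\<close>

lemma adj_mult_self_eq_zero:
  assumes A: "A \<in> carrier_mat n m" and "Re (mtrace (adj A * A)) \<le> 0"
  shows "A = 0\<^sub>m n m"
proof (rule eq_matI)
  fix l i assume "l < dim_row (0\<^sub>m n m :: complex mat)" "i < dim_col (0\<^sub>m n m :: complex mat)"
  then have li: "l < n" "i < m" by auto
  have "(\<Sum>i<m. \<Sum>l<n. (cmod (A $$ (l,i)))\<^sup>2) \<le> 0"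
    using assms(2) mtrace_adj_mult_self[OF A] by simp
  moreover have "(cmod (A $$ (l,i)))\<^sup>2 \<le> (\<Sum>l<n. (cmod (A $$ (l,i)))\<^sup>2)"
    using li by (intro member_le_sum) auto
  moreover have "(\<Sum>l<n. (cmod (A $$ (l,i)))\<^sup>2) \<le> (\<Sum>i<m. \<Sum>l<n. (cmod (A $$ (l,i)))\<^sup>2)"
    using li by (intro member_le_sum[of i "{..<m}" "\<lambda>i. \<Sum>l<n. (cmod (A $$ (l,i)))\<^sup>2"]) (auto intro: sum_nonneg)
  ultimately have "(cmod (A $$ (l,i)))\<^sup>2 \<le> 0" by linarith
  then show "A $$ (l,i) = 0\<^sub>m n m $$ (l,i)" using li by simp
qed (use A in auto)

section \<open>Quadratic forms and positivity\<close>

lemma quadratic_form_sum: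
  assumes "A \<in> carrier_mat n n" "v \<in> carrier_vec n"
  shows "(A *\<^sub>v v) \<bullet>c v = (\<Sum>i<n. \<Sum>j<n. cnj (v $ i) * A $$ (i,j) * v $ j)"
proof -
  have "(A *\<^sub>v v) \<bullet>c v = (\<Sum>i<n. (\<Sum>j<n. A $$ (i,j) * v $ j) * cnj (v $ i))"
    using assms by (auto simp: scalar_prod_def atLeast0LessThan intro!: sum.cong)
  then show ?thesis
    by (simp add: sum_distrib_left sum_distrib_right mult_ac)
qed

lemma hermitian_mat_iff: "A \<in> carrier_mat n n \<Longrightarrow> hermitian_mat A \<longleftrightarrow> adj A = A"
  by (auto simp: hermitian_mat_def)

text \<open>Test vectors become functions on all of \<open>nat\<close>, free of a dimension
  constraint; this suits the reindexing of the quadratic form in the Kraus argument.\<close>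

lemma psd_iff:
  assumes A: "A \<in> carrier_mat n n"
  shows "psd A \<longleftrightarrow> adj A = A \<and> (\<forall>x::nat \<Rightarrow> complex. 0 \<le> Re (\<Sum>i<n. \<Sum>j<n. cnj (x i) * A $$ (i,j) * x j))"
proof -
  have "(\<forall>v \<in> carrier_vec n. 0 \<le> Re ((A *\<^sub>v v) \<bullet>c v))
    \<longleftrightarrow> (\<forall>x::nat \<Rightarrow> complex. 0 \<le> Re (\<Sum>i<n. \<Sum>j<n. cnj (x i) * A $$ (i,j) * x j))" (is "?l = ?r")
  proof
    assume ?l
    show ?r
    proof
      fix x :: "nat \<Rightarrow> complex"
      have "0 \<le> Re ((A *\<^sub>v vec n x) \<bullet>c vec n x)" using \<open>?l\<close> by auto
      then show "0 \<le> Re (\<Sum>i<n. \<Sum>j<n. cnj (x i) * A $$ (i,j) * x j)"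
        by (subst (asm) quadratic_form_sum[OF A]) auto
    qed
  next
    assume ?r
    then show ?l by (simp add: quadratic_form_sum[OF A])
  qed
  then show ?thesis using A by (auto simp: psd_def hermitian_mat_iff)
qed

lemma psdD_hermitian: "psd A \<Longrightarrow> adj A = A"
  by (auto simp: psd_def hermitian_mat_def)

lemma psd_carrier: "psd A \<Longrightarrow> A \<in> carrier_mat (dim_row A) (dim_row A)"
  by (auto simp: psd_def hermitian_mat_def)

lemma adj_mult_vec_scalar_prod:
  assumes "B \<in> carrier_mat n m" "u \<in> carrier_vec n" "v \<in> carrier_vec m"
  shows "(adj B *\<^sub>v u) \<bullet>c v = u \<bullet>c (B *\<^sub>v v)"
proof -
  have "(adj B *\<^sub>v u) \<bullet>c v = (\<Sum>i<m. \<Sum>l<n. cnj (B $$ (l,i)) * u $ l * cnj (v $ i))"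
    using assms by (auto simp: scalar_prod_def atLeast0LessThan sum_distrib_right intro!: sum.cong)
  also have "\<dots> = (\<Sum>l<n. \<Sum>i<m. cnj (B $$ (l,i)) * u $ l * cnj (v $ i))"
    by (rule sum.swap)
  also have "\<dots> = (\<Sum>l<n. u $ l * cnj (\<Sum>i<m. B $$ (l,i) * v $ i))"
    by (simp add: sum_distrib_left mult_ac)
  also have "\<dots> = u \<bullet>c (B *\<^sub>v v)"
    using assms by (auto simp: scalar_prod_def atLeast0LessThan intro!: sum.cong)
  finally show ?thesis .
qed

text \<open>The quadratic form at \<open>v\<close> is that of \<open>A\<close> at
  \<open>B *\<^sub>v v\<close>. A rectangular \<open>B\<close> is allowed, so that a single row can
  later produce the rank-one matrix \<open>max_ent\<close>.\<close>

lemma psd_congruence: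
  assumes A: "A \<in> carrier_mat n n" "psd A" and B: "B \<in> carrier_mat n m"
  shows "psd (adj B * A * B)"
proof -
  have B': "adj B \<in> carrier_mat m n" using B by auto
  have C: "adj B * A * B \<in> carrier_mat m m" using A B B' by auto
  have "adj (adj B * A * B) = adj B * A * B"
    using adj_congruence[OF A(1) B] psdD_hermitian[OF A(2)] by simp
  moreover have "0 \<le> Re (((adj B * A * B) *\<^sub>v v) \<bullet>c v)" if v: "v \<in> carrier_vec m" for v
  proof -
    have "(adj B * A * B) *\<^sub>v v = adj B *\<^sub>v (A *\<^sub>v (B *\<^sub>v v))"
      using assoc_mult_mat_vec[of "adj B * A" m n B m v] assoc_mult_mat_vec[of "adj B" m n A n "B *\<^sub>v v"]
        A B B' v by (simp del: assoc_mult_mat)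
    then have "((adj B * A * B) *\<^sub>v v) \<bullet>c v = (A *\<^sub>v (B *\<^sub>v v)) \<bullet>c (B *\<^sub>v v)"
      using A B v by (simp add: adj_mult_vec_scalar_prod[of B n m])
    then show ?thesis using A B v by (auto simp: psd_def)
  qed
  ultimately show ?thesis using C unfolding psd_def hermitian_mat_def by auto
qed

lemma psd_one: "psd (1\<^sub>m n)"
proof -
  have "0 \<le> Re (\<Sum>i<n. \<Sum>j<n. cnj (x i) * 1\<^sub>m n $$ (i,j) * x j)" for x :: "nat \<Rightarrow> complex"
  proof -
    have "(\<Sum>i<n. \<Sum>j<n. cnj (x i) * 1\<^sub>m n $$ (i,j) * x j) = (\<Sum>i<n. cnj (x i) * x i)"
    proof (rule sum.cong[OF refl])
      fix i assume "i \<in> {..<n}"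
      then have "(\<Sum>j<n. cnj (x i) * 1\<^sub>m n $$ (i,j) * x j) = (\<Sum>j<n. if j = i then cnj (x i) * x i else 0)"
        by (intro sum.cong) auto
      then show "(\<Sum>j<n. cnj (x i) * 1\<^sub>m n $$ (i,j) * x j) = cnj (x i) * x i"
        using \<open>i \<in> {..<n}\<close> by simp
    qed
    then show ?thesis by (simp add: sum_nonneg)
  qed
  then show ?thesis using psd_iff[of "1\<^sub>m n" n] by simp
qed

lemma psd_adj_mult_self:
  assumes "B \<in> carrier_mat n m"
  shows "psd (adj B * B)"
  using psd_congruence[OF one_carrier_mat psd_one assms] assms by (simp add: right_mult_one_mat[of _ m n])

lemma psd_diag_nonneg:
  assumes A: "A \<in> carrier_mat n n" "psd A" and i: "i < n"
  shows "0 \<le> Re (A $$ (i,i))"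
proof -
  have "(\<Sum>k<n. \<Sum>j<n. cnj (if k = i then 1 else 0) * A $$ (k,j) * (if j = i then 1 else 0))
    = (\<Sum>k<n. if k = i then A $$ (k,i) else 0)"
  proof (rule sum.cong[OF refl])
    fix k assume "k \<in> {..<n}"
    have "(\<Sum>j<n. cnj (if k = i then 1 else 0) * A $$ (k,j) * (if j = i then 1 else 0))
       = (\<Sum>j<n. if j = i then cnj (if k = i then 1 else 0) * A $$ (k,i) else 0)"
      by (intro sum.cong) auto
    then show "(\<Sum>j<n. cnj (if k = i then 1 else 0) * A $$ (k,j) * (if j = i then 1 else 0))
      = (if k = i then A $$ (k,i) else 0)" using i by simp
  qed
  then show ?thesis
    using spec[OF conjunct2[OF A(2)[unfolded psd_iff[OF A(1)]]], of "\<lambda>k. if k = i then 1 else 0"] i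
    by simp
qed

lemma psd_mtrace_nonneg: "A \<in> carrier_mat n n \<Longrightarrow> psd A \<Longrightarrow> 0 \<le> Re (mtrace A)"
  by (auto simp: mtrace_carrier intro!: sum_nonneg psd_diag_nonneg)

section \<open>Spectral theorem\<close>

text \<open>Complete \<open>v\<close> to a basis, orthogonalise it by Gram-Schmidt and normalise the
  columns. The scalar \<open>c\<close> absorbs the normalisation of \<open>v\<close>.\<close>

lemma unitary_extension:
  fixes v :: "complex vec"
  assumes v: "v \<in> carrier_vec n" "v \<noteq> 0\<^sub>v n"
  shows "\<exists>W c. W \<in> carrier_mat n n \<and> adj W * W = 1\<^sub>m n \<and> col W 0 = c \<cdot>\<^sub>v v"
proof -
  interpret cof_vec_space n "TYPE(complex)" .
  define b where "b = basis_completion v"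
  define ws where "ws = gram_schmidt n b"
  from basis_completion[OF v, folded b_def]
  have b: "distinct b" "\<not> lin_dep (set b)" "set b \<subseteq> carrier_vec n" "hd b = v" "length b = n"
    by auto
  have n: "n > 0" using v by (cases n) auto
  obtain vs where bv: "b = v # vs" using b n by (cases b) auto
  from gram_schmidt_result[OF b(3,1,2) refl, folded ws_def]
  have ws: "set ws \<subseteq> carrier_vec n" "corthogonal ws" "length ws = n"
    by (auto simp: b)
  \<comment> \<open>Gram-Schmidt leaves the first vector unchanged, so \<open>v\<close> survives as
    the head of the orthogonal family.\<close>
  have hd: "ws ! 0 = v"
    using gram_schmidt_hd[OF v(1), of vs, folded bv] ws n
    unfolding ws_def by (subst hd_conv_nth[symmetric]) auto
  have wsc: "ws ! j \<in> carrier_vec n" if "j < n" for j using ws that by auto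
  \<comment> \<open>The family \<open>ws\<close> is only orthogonal, not orthonormal;
    \<open>r j\<close> is the length of its member \<open>j\<close>.\<close>
  define r where "r j = sqrt (Re (ws ! j \<bullet>c ws ! j))" for j
  have r: "ws ! j \<bullet>c ws ! j = complex_of_real (r j * r j) \<and> r j \<noteq> 0" if j: "j < n" for j
  proof -
    have *: "ws ! j \<bullet>c ws ! j = (\<Sum>i<n. complex_of_real ((cmod (ws ! j $ i))\<^sup>2))"
      using wsc[OF j]
      by (auto simp: scalar_prod_def atLeast0LessThan complex_norm_square simp del: of_real_power intro!: sum.cong)
    have "ws ! j \<bullet>c ws ! j \<noteq> 0" using corthogonalD[OF ws(2), of j j] ws(3) j by auto
    moreover have "0 \<le> Re (ws ! j \<bullet>c ws ! j)" unfolding * Re_sum by (intro sum_nonneg) auto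
    moreover have "Im (ws ! j \<bullet>c ws ! j) = 0" unfolding * Im_sum by simp
    ultimately show ?thesis unfolding r_def by (auto simp: complex_eq_iff)
  qed
  define W where "W = mat n n (\<lambda>(i,j). ws ! j $ i / complex_of_real (r j))"
  have W: "W \<in> carrier_mat n n" by (auto simp: W_def)
  have "adj W * W = 1\<^sub>m n"
  proof (rule eq_matI)
    fix i j assume "i < dim_row (1\<^sub>m n :: complex mat)" "j < dim_col (1\<^sub>m n :: complex mat)"
    then have ij: "i < n" "j < n" by auto
    have "(adj W * W) $$ (i,j) = (\<Sum>l<n. cnj (ws ! i $ l / complex_of_real (r i)) * (ws ! j $ l / complex_of_real (r j)))"
      using ij by (subst index_mult_mat_sum[OF adj_carrier[OF W] W]) (auto simp: W_def)
    also have "\<dots> = (\<Sum>l<n. ws ! j $ l * cnj (ws ! i $ l)) / complex_of_real (r i * r j)"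
      by (simp add: sum_divide_distrib field_simps)
    also have "(\<Sum>l<n. ws ! j $ l * cnj (ws ! i $ l)) = ws ! j \<bullet>c ws ! i"
      using wsc[OF ij(1)] wsc[OF ij(2)] by (auto simp: scalar_prod_def atLeast0LessThan)
    also have "ws ! j \<bullet>c ws ! i / complex_of_real (r i * r j) = (if i = j then 1 else 0)"
      using r[OF ij(1)] corthogonalD[OF ws(2), of j i] ws(3) ij by auto
    finally show "(adj W * W) $$ (i,j) = 1\<^sub>m n $$ (i,j)" using ij by simp
  qed (use W in auto)
  moreover have "col W 0 = (1 / complex_of_real (r 0)) \<cdot>\<^sub>v v"
    using n v hd by (auto simp: W_def)
  ultimately show ?thesis using W by blast
qed

definition diag_real :: "nat \<Rightarrow> (nat \<Rightarrow> real) \<Rightarrow> complex mat" where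
  "diag_real n f = mat n n (\<lambda>(i,j). if i = j then complex_of_real (f i) else 0)"

lemma diag_real_carrier [simp, intro]: "diag_real n f \<in> carrier_mat n n"
  by (auto simp: diag_real_def)

lemma diag_real_dim [simp]: "dim_row (diag_real n f) = n" "dim_col (diag_real n f) = n"
  by (auto simp: diag_real_def)

lemma adj_diag_real [simp]: "adj (diag_real n f) = diag_real n f"
  by (rule eq_matI) (auto simp: diag_real_def)

lemma diag_real_mult_index:
  assumes "A \<in> carrier_mat n n" "i < n" "j < n"
  shows "(diag_real n f * A) $$ (i,j) = f i * A $$ (i,j)"
    and "(A * diag_real n f) $$ (i,j) = A $$ (i,j) * f j"
proof -
  have "(diag_real n f * A) $$ (i,j) = (\<Sum>l<n. diag_real n f $$ (i,l) * A $$ (l,j))"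
    using assms by (intro index_mult_mat_sum) auto
  also have "\<dots> = (\<Sum>l<n. if l = i then complex_of_real (f i) * A $$ (i,j) else 0)"
    using assms by (intro sum.cong) (auto simp: diag_real_def)
  finally show "(diag_real n f * A) $$ (i,j) = f i * A $$ (i,j)" using assms by simp
  have "(A * diag_real n f) $$ (i,j) = (\<Sum>l<n. A $$ (i,l) * diag_real n f $$ (l,j))"
    using assms by (intro index_mult_mat_sum) auto
  also have "\<dots> = (\<Sum>l<n. if l = j then A $$ (i,j) * complex_of_real (f j) else 0)"
    using assms by (intro sum.cong) (auto simp: diag_real_def)
  finally show "(A * diag_real n f) $$ (i,j) = A $$ (i,j) * f j" using assms by simp
qed

lemma diag_real_mult: "diag_real n f * diag_real n g = diag_real n (\<lambda>i. f i * g i)"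
proof (rule eq_matI)
  fix i j assume "i < dim_row (diag_real n (\<lambda>i. f i * g i))" "j < dim_col (diag_real n (\<lambda>i. f i * g i))"
  then have ij: "i < n" "j < n" by auto
  show "(diag_real n f * diag_real n g) $$ (i,j) = diag_real n (\<lambda>i. f i * g i) $$ (i,j)"
    using diag_real_mult_index(1)[OF diag_real_carrier ij, of f g] ij by (simp add: diag_real_def del: index_mult_mat(1))
qed auto

text \<open>Deflation, by induction on the dimension: a unitary \<open>W\<close> whose first column
  is an eigenvector turns \<open>A\<close> into a matrix with first column \<open>e\<close> times
  the first unit vector. Hermiticity clears the first row too, and the induction hypothesis treats
  the remaining block.\<close>

theorem hermitian_diagonalization:
  assumes "A \<in> carrier_mat n n" "adj A = A"
  shows "\<exists>Q f. Q \<in> carrier_mat n n \<and> adj Q * Q = 1\<^sub>m n \<and> A = Q * diag_real n f * adj Q"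
  using assms
proof (induction n arbitrary: A)
  case 0
  have "A = 1\<^sub>m 0 * diag_real 0 f * adj (1\<^sub>m 0)" for f
    using 0 by (intro eq_matI) auto
  then show ?case by (metis adj_one left_mult_one_mat one_carrier_mat)
next
  case (Suc n)
  let ?N = "Suc n"
  have A: "A \<in> carrier_mat ?N ?N" by fact
  have dA [simp]: "dim_row A = ?N" "dim_col A = ?N" using A by auto
  obtain e where "eigenvalue A e" using spectrum_non_empty[OF A] by (auto simp: spectrum_def)
  then obtain v where v: "v \<in> carrier_vec ?N" "v \<noteq> 0\<^sub>v ?N" "A *\<^sub>v v = e \<cdot>\<^sub>v v"
    using A by (auto simp: eigenvalue_def eigenvector_def)
  obtain W c where W: "W \<in> carrier_mat ?N ?N" "adj W * W = 1\<^sub>m ?N" "col W 0 = c \<cdot>\<^sub>v v"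
    using unitary_extension[OF v(1,2)] by auto
  have dW [simp]: "dim_row W = ?N" "dim_col W = ?N" using W by auto
  have WW: "W * adj W = 1\<^sub>m ?N" using mat_mult_left_right_inverse[OF adj_carrier[OF W(1)] W(1,2)] .
  define A' where "A' = adj W * A * W"
  have A': "A' \<in> carrier_mat ?N ?N" unfolding A'_def using A W by auto
  have A'h: "adj A' = A'"
    unfolding A'_def using adj_congruence[OF A W(1)] Suc.prems(2) by simp
  have cAW: "col (A * W) 0 = e \<cdot>\<^sub>v col W 0"
  proof -
    have "col (A * W) 0 = A *\<^sub>v col W 0" using A W by (intro col_mult2) auto
    also have "\<dots> = c \<cdot>\<^sub>v (A *\<^sub>v v)" unfolding W(3) by (rule mult_mat_vec[OF A v(1)])
    finally show ?thesis unfolding v(3) W(3) by (simp add: smult_smult_assoc mult.commute)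
  qed
  have col0: "A' $$ (i,0) = (if i = 0 then e else 0)" if i: "i < ?N" for i
  proof -
    have "A' $$ (i,0) = (adj W * (A * W)) $$ (i,0)" unfolding A'_def by (simp add: mult_mat_assoc)
    also have "\<dots> = row (adj W) i \<bullet> (e \<cdot>\<^sub>v col W 0)" using i cAW by simp
    also have "\<dots> = e * (row (adj W) i \<bullet> col W 0)"
      using i W v by (intro scalar_prod_smult_distrib[of _ ?N]) auto
    also have "row (adj W) i \<bullet> col W 0 = (adj W * W) $$ (i,0)" using i by simp
    finally show ?thesis using i W by simp
  qed
  have A'sym: "A' $$ (i,j) = cnj (A' $$ (j,i))" if "i < ?N" "j < ?N" for i j
    using that A' arg_cong[OF A'h, of "\<lambda>M. M $$ (i,j)"] by auto
  have row0: "A' $$ (0,i) = (if i = 0 then e else 0)" if i: "i < ?N" for i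
    using A'sym[OF _ i, of 0] col0[OF i] col0[of 0] A'sym[of 0 0] by auto
  \<comment> \<open>A diagonal entry of a Hermitian matrix is real, as \<open>diag_real\<close>
    requires of the eigenvalues.\<close>
  have e: "e = complex_of_real (Re e)"
    using A'sym[of 0 0] col0[of 0] by (simp add: complex_eq_iff)
  define A3 where "A3 = mat n n (\<lambda>(i,j). A' $$ (Suc i, Suc j))"
  have A3: "A3 \<in> carrier_mat n n" by (auto simp: A3_def)
  have "adj A3 = A3"
    by (rule eq_matI) (auto simp: A3_def A'sym[symmetric])
  from Suc.IH[OF A3 this] obtain Q f where
    Q: "Q \<in> carrier_mat n n" "adj Q * Q = 1\<^sub>m n" "A3 = Q * diag_real n f * adj Q" by auto
  have dQ [simp]: "dim_row Q = n" "dim_col Q = n" using Q by auto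
  \<comment> \<open>The direct sum of 1 and \<open>Q\<close> keeps the first coordinate and
    diagonalises the remaining block; \<open>W * R\<close> will diagonalise
    \<open>A\<close>.\<close>
  define R where "R = four_block_mat (1\<^sub>m 1) (0\<^sub>m 1 n) (0\<^sub>m n 1) Q"
  define E where "E = diag_real 1 (\<lambda>_. Re e)"
  define g where "g = case_nat (Re e) f"
  have R: "R \<in> carrier_mat ?N ?N" unfolding R_def using four_block_carrier_mat[OF one_carrier_mat[of 1] Q(1)] by simp
  have dR [simp]: "dim_row R = ?N" "dim_col R = ?N" using R by auto
  have adjR: "adj R = four_block_mat (1\<^sub>m 1) (0\<^sub>m 1 n) (0\<^sub>m n 1) (adj Q)"
    unfolding R_def using adj_four_block_mat[OF one_carrier_mat[of 1] zero_carrier_mat zero_carrier_mat Q(1)] by simp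
  have Ec: "E \<in> carrier_mat 1 1" by (auto simp: E_def)
  have "adj R * R = four_block_mat (1\<^sub>m 1) (0\<^sub>m 1 n) (0\<^sub>m n 1) (1\<^sub>m n)"
    unfolding adjR unfolding R_def
    using mult_four_block_mat[OF one_carrier_mat[of 1] zero_carrier_mat zero_carrier_mat adj_carrier[OF Q(1)]
        one_carrier_mat[of 1] zero_carrier_mat zero_carrier_mat Q(1)] Q(1,2) by simp
  then have RR: "adj R * R = 1\<^sub>m ?N" by simp
  have dg: "diag_real ?N g = four_block_mat E (0\<^sub>m 1 n) (0\<^sub>m n 1) (diag_real n f)"
    by (rule eq_matI) (auto simp: diag_real_def E_def g_def split: nat.splits)
  have "R * diag_real ?N g * adj R = four_block_mat E (0\<^sub>m 1 n) (0\<^sub>m n 1) A3"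
  proof -
    have "R * diag_real ?N g = four_block_mat E (0\<^sub>m 1 n) (0\<^sub>m n 1) (Q * diag_real n f)"
      unfolding dg R_def
      using mult_four_block_mat[OF one_carrier_mat[of 1] zero_carrier_mat zero_carrier_mat Q(1)
          Ec zero_carrier_mat zero_carrier_mat diag_real_carrier] Q(1) Ec by simp
    moreover have "Q * diag_real n f \<in> carrier_mat n n" using Q(1) by simp
    note mult_four_block_mat[OF Ec zero_carrier_mat zero_carrier_mat this
          one_carrier_mat[of 1] zero_carrier_mat zero_carrier_mat adj_carrier[OF Q(1)]]
    ultimately show ?thesis
      unfolding adjR Q(3) using Q(1) Ec by (simp add: left_add_zero_mat[OF A3[unfolded Q(3)]])
  qed
  also have "\<dots> = A'"
    using A' by (intro eq_matI)
      (auto simp: E_def A3_def diag_real_def col0 row0 e[symmetric] less_Suc_eq_0_disj)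
  finally have A'R: "A' = R * diag_real ?N g * adj R" ..
  have "A = (W * adj W) * A * (W * adj W)" using WW A by simp
  also have "\<dots> = W * A' * adj W" unfolding A'_def by (simp add: mult_mat_assoc)
  also have "\<dots> = (W * R) * diag_real ?N g * adj (W * R)"
    unfolding A'R adj_mult[OF W(1) R] by (simp add: mult_mat_assoc)
  finally have "A = (W * R) * diag_real ?N g * adj (W * R)" .
  moreover have "adj (W * R) * (W * R) = adj R * ((adj W * W) * R)"
    unfolding adj_mult[OF W(1) R] by (simp add: mult_mat_assoc)
  then have "adj (W * R) * (W * R) = 1\<^sub>m ?N" unfolding W(2) using RR R by simp
  moreover have "W * R \<in> carrier_mat ?N ?N" using W R by auto
  ultimately show ?case by blast
qed

section \<open>Square roots and polar decomposition\<close>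

text \<open>The function is applied to the index of an eigenvector, not to an eigenvalue. Matrices
  sharing the eigenbasis \<open>Q\<close> then multiply by pointwise products, which handles roots
  and pseudo-inverses alike.\<close>

definition spectral_fun :: "complex mat \<Rightarrow> (nat \<Rightarrow> real) \<Rightarrow> complex mat" where
  "spectral_fun Q f = Q * diag_real (dim_row Q) f * adj Q"

context
  fixes Q :: "complex mat" and n :: nat
  assumes Q: "Q \<in> carrier_mat n n" and QQ: "adj Q * Q = 1\<^sub>m n"
begin

private lemma dimQ [simp]: "dim_row Q = n" "dim_col Q = n"
  using Q by auto

private lemma QQ': "Q * adj Q = 1\<^sub>m n"
  using mat_mult_left_right_inverse[OF adj_carrier[OF Q] Q QQ] .

lemma spectral_fun_carrier: "spectral_fun Q f \<in> carrier_mat n n"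
  unfolding spectral_fun_def by (auto intro!: carrier_matI)

lemma spectral_fun_dim: "dim_row (spectral_fun Q f) = n" "dim_col (spectral_fun Q f) = n"
  unfolding spectral_fun_def by simp_all

lemma spectral_fun_cong: "(\<And>i. i < n \<Longrightarrow> f i = g i) \<Longrightarrow> spectral_fun Q f = spectral_fun Q g"
proof -
  assume "\<And>i. i < n \<Longrightarrow> f i = g i"
  then have "diag_real n f = diag_real n g" by (intro eq_matI) (auto simp: diag_real_def)
  then show ?thesis by (simp add: spectral_fun_def)
qed

lemma spectral_fun_one: "spectral_fun Q (\<lambda>_. 1) = 1\<^sub>m n"
proof -
  have "diag_real n (\<lambda>_. 1) = 1\<^sub>m n" by (rule eq_matI) (auto simp: diag_real_def)
  then show ?thesis unfolding spectral_fun_def using Q QQ' by simp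
qed

lemma adj_spectral_fun: "adj (spectral_fun Q f) = spectral_fun Q f"
  using adj_congruence[of "diag_real n f" n "adj Q" n] adj_carrier[OF Q] unfolding spectral_fun_def by simp

lemma spectral_fun_mult: "spectral_fun Q f * spectral_fun Q g = spectral_fun Q (\<lambda>i. f i * g i)"
proof -
  have "spectral_fun Q f * spectral_fun Q g = Q * (diag_real n f * ((adj Q * Q) * (diag_real n g * adj Q)))"
    unfolding spectral_fun_def by (simp add: mult_mat_assoc)
  also have "(adj Q * Q) * (diag_real n g * adj Q) = diag_real n g * adj Q"
    unfolding QQ using Q by (intro left_mult_one_mat[of _ n n]) auto
  finally show ?thesis
    unfolding spectral_fun_def by (simp add: mult_mat_assoc diag_real_mult[symmetric])
qed

lemma adj_congruence_spectral_fun: "adj Q * spectral_fun Q f * Q = diag_real n f"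
proof -
  have "adj Q * spectral_fun Q f * Q = (adj Q * Q) * (diag_real n f * (adj Q * Q))"
    unfolding spectral_fun_def by (simp add: mult_mat_assoc)
  then show ?thesis unfolding QQ by simp
qed

text \<open>Conjugation by \<open>Q\<close> leaves the diagonal matrix, whose entries can be read
  off; conversely the pointwise square root gives a factorisation \<open>adj B * B\<close>.\<close>

lemma psd_spectral_fun_iff: "psd (spectral_fun Q f) \<longleftrightarrow> (\<forall>i<n. 0 \<le> f i)"
proof
  assume "psd (spectral_fun Q f)"
  then have "psd (diag_real n f)"
    using psd_congruence[OF spectral_fun_carrier _ Q] by (simp add: adj_congruence_spectral_fun)
  then show "\<forall>i<n. 0 \<le> f i"
    using psd_diag_nonneg[OF diag_real_carrier] by (fastforce simp: diag_real_def)
next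
  assume f: "\<forall>i<n. 0 \<le> f i"
  have "spectral_fun Q f = adj (spectral_fun Q (\<lambda>i. sqrt (f i))) * spectral_fun Q (\<lambda>i. sqrt (f i))"
    unfolding adj_spectral_fun spectral_fun_mult using f by (intro spectral_fun_cong) auto
  then show "psd (spectral_fun Q f)"
    using psd_adj_mult_self[OF spectral_fun_carrier] by simp
qed

end

text \<open>In an eigenbasis of \<open>P - R\<close> the two matrices become \<open>T\<close> and
  \<open>T'\<close> with diagonal difference \<open>f\<close>. Equality of the squares gives
  \<open>f i\<close> times the sum of the diagonal entries of \<open>T\<close> and \<open>T'\<close>
  equal to 0. As \<open>f i\<close> is the difference of these nonnegative entries, it vanishes
  either way. Uniqueness is what gives the description in \<open>trace_norm\<close> a
  meaning.\<close>

lemma psd_sqrt_unique: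
  assumes P: "P \<in> carrier_mat n n" "psd P" and R: "R \<in> carrier_mat n n" "psd R"
    and eq: "P * P = R * R"
  shows "P = R"
proof -
  have dims [simp]: "dim_row P = n" "dim_col P = n" "dim_row R = n" "dim_col R = n" using P R by auto
  have H: "P - R \<in> carrier_mat n n" by (rule minus_carrier_mat[OF R(1)])
  have "adj (P - R) = P - R"
    using adj_minus[OF P(1) R(1)] psdD_hermitian[OF P(2)] psdD_hermitian[OF R(2)] by simp
  from hermitian_diagonalization[OF H this] obtain Q f where
    Q: "Q \<in> carrier_mat n n" "adj Q * Q = 1\<^sub>m n" "P - R = Q * diag_real n f * adj Q" by auto
  have dQ [simp]: "dim_row Q = n" "dim_col Q = n" using Q by auto
  have QQ': "Q * adj Q = 1\<^sub>m n"
    using mat_mult_left_right_inverse[OF adj_carrier[OF Q(1)] Q(1,2)] .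
  define T where "T = adj Q * P * Q"
  define T' where "T' = adj Q * R * Q"
  have T: "T \<in> carrier_mat n n" "psd T" and T': "T' \<in> carrier_mat n n" "psd T'"
    unfolding T_def T'_def using psd_congruence[OF P Q(1)] psd_congruence[OF R Q(1)]
    by (auto intro!: carrier_matI)
  have sq: "adj Q * A * Q * (adj Q * A * Q) = adj Q * (A * A) * Q" if A: "A \<in> carrier_mat n n" for A
  proof -
    have "adj Q * A * Q * (adj Q * A * Q) = adj Q * (A * ((Q * adj Q) * (A * Q)))"
      using A by (simp add: mult_mat_assoc)
    then show ?thesis unfolding QQ' using A by (simp add: mult_mat_assoc)
  qed
  have TT: "T * T = T' * T'" unfolding T_def T'_def sq[OF P(1)] sq[OF R(1)] eq ..
  have "T - T' = adj Q * (P - R) * Q"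
    unfolding T_def T'_def by (simp add: mult_mat_distrib)
  also have "\<dots> = (adj Q * Q) * (diag_real n f * (adj Q * Q))"
    unfolding Q(3) by (simp add: mult_mat_assoc)
  also have "\<dots> = diag_real n f" unfolding Q(2) by simp
  finally have diff: "T - T' = diag_real n f" .
  have f: "f i = 0" if i: "i < n" for i
  proof -
    \<comment> \<open>This splitting of a difference of squares holds without commutativity, and
      both terms contain the diagonal factor \<open>T - T'\<close>.\<close>
    have "T * T - T' * T' = T * (T - T') + (T - T') * T'"
    proof -
      have c: "T * T \<in> carrier_mat n n" "T * T' \<in> carrier_mat n n" "T' * T' \<in> carrier_mat n n"
        using T T' by (simp_all add: mult_carrier_mat[of _ n n])
      have "T * (T - T') + (T - T') * T' = (T * T - T * T') + (T * T' - T' * T')"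
        using T T' by (simp add: mult_mat_distrib)
      also have "\<dots> = T * T - T' * T'"
        using c carrier_matD[OF T(1)] carrier_matD[OF T'(1)] by (intro eq_matI) (auto simp del: index_mult_mat(1))
      finally show ?thesis ..
    qed
    then have "T * diag_real n f + diag_real n f * T' = 0\<^sub>m n n"
      unfolding TT diff using T T' by (simp add: minus_r_inv_mat[of _ n n])
    then have "(T * diag_real n f + diag_real n f * T') $$ (i,i) = 0" using i by simp
    then have "T $$ (i,i) * f i + f i * T' $$ (i,i) = 0"
      using diag_real_mult_index(2)[OF T(1) i i, of f] diag_real_mult_index(1)[OF T'(1) i i, of f] T T' i
      by (simp del: index_mult_mat(1))
    then have "Re (T $$ (i,i) * f i + f i * T' $$ (i,i)) = 0" by simp
    then have "f i * (Re (T $$ (i,i)) + Re (T' $$ (i,i))) = 0" by (simp add: algebra_simps)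
    moreover have "Re (T $$ (i,i)) - Re (T' $$ (i,i)) = f i"
      using arg_cong[OF diff, of "\<lambda>M. Re (M $$ (i,i))"] T T' i by (simp add: diag_real_def)
    ultimately show ?thesis
      using psd_diag_nonneg[OF T i] psd_diag_nonneg[OF T' i] by auto
  qed
  have "diag_real n f = 0\<^sub>m n n" by (rule eq_matI) (auto simp: diag_real_def f)
  then have "P - R = 0\<^sub>m n n" using Q by simp
  then have "(P - R) $$ (i,j) = 0" if "i < n" "j < n" for i j using that by simp
  then show ?thesis using P R by (intro eq_matI) auto
qed

lemma trace_norm_eq:
  assumes X: "X \<in> carrier_mat n n" and P: "P \<in> carrier_mat n n" "psd P" "P * P = adj X * X"
  shows "trace_norm X = Re (mtrace P)"
proof -
  have "(THE P. psd P \<and> P * P = adj X * X) = P"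
  proof (rule the_equality)
    fix R assume R: "psd R \<and> R * R = adj X * X"
    \<comment> \<open>The description in \<open>trace_norm\<close> does not fix the size of its
      candidates; it is read off from the product.\<close>
    then have "dim_row (R * R) = dim_row (adj X * X)" by simp
    then have "dim_row R = n" using X by simp
    then have "R \<in> carrier_mat n n" using psd_carrier[of R] R by simp
    then show "R = P" using psd_sqrt_unique[of R n P] R P by auto
  qed (use P in auto)
  then show ?thesis by (simp add: trace_norm_def)
qed

lemma trace_norm_psd:
  assumes "A \<in> carrier_mat n n" "psd A"
  shows "trace_norm A = Re (mtrace A)"
  using trace_norm_eq[OF assms(1) assms] psdD_hermitian[OF assms(2)] by simp

lemma psd_sqrt_exists:
  assumes A: "A \<in> carrier_mat n n" "psd A"
  shows "\<exists>S. S \<in> carrier_mat n n \<and> psd S \<and> S * S = A"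
proof -
  obtain Q f where Q: "Q \<in> carrier_mat n n" "adj Q * Q = 1\<^sub>m n" "A = spectral_fun Q f"
    using hermitian_diagonalization[OF A(1) psdD_hermitian[OF A(2)]] by (auto simp: spectral_fun_def)
  note [simp] = spectral_fun_mult[OF Q(1,2)] psd_spectral_fun_iff[OF Q(1,2)]
  have f: "\<forall>i<n. 0 \<le> f i" using A Q(3) by simp
  then have "spectral_fun Q (\<lambda>i. sqrt (f i)) * spectral_fun Q (\<lambda>i. sqrt (f i)) = A"
    unfolding Q(3) by (auto intro!: spectral_fun_cong[OF Q(1,2)])
  then show ?thesis using f spectral_fun_carrier[OF Q(1,2)]
    by (intro exI[of _ "spectral_fun Q (\<lambda>i. sqrt (f i))"]) auto
qed

text \<open>The partial isometry \<open>U\<close> is \<open>X\<close> times the pseudo-inverse of \<open>P = |X|\<close>;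
  the latter is supplied by the convention \<open>inverse 0 = 0\<close>.\<close>

theorem polar_decomposition:
  assumes X: "X \<in> carrier_mat n n"
  shows "\<exists>U P S. U \<in> carrier_mat n n \<and> P \<in> carrier_mat n n \<and> S \<in> carrier_mat n n \<and>
    psd P \<and> psd S \<and> S * S = P \<and> P * P = adj X * X \<and> U * P = X \<and> adj U * X = P \<and>
    adj U * U * S = S \<and> U * adj U * (U * adj U) = U * adj U"
proof -
  have dX [simp]: "dim_row X = n" "dim_col X = n" using X by auto
  have XX: "adj X * X \<in> carrier_mat n n" by (auto intro!: carrier_matI)
  obtain Q g where Q: "Q \<in> carrier_mat n n" "adj Q * Q = 1\<^sub>m n" "adj X * X = spectral_fun Q g"
    using hermitian_diagonalization[OF XX psdD_hermitian[OF psd_adj_mult_self[OF X]]]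
    by (auto simp: spectral_fun_def)
  let ?F = "spectral_fun Q"
  note F [simp] = spectral_fun_mult[OF Q(1,2)] psd_spectral_fun_iff[OF Q(1,2)]
    spectral_fun_dim[OF Q(1,2)] adj_spectral_fun[OF Q(1,2)]
  note Fc = spectral_fun_carrier[OF Q(1,2)]
  note F_cong = spectral_fun_cong[OF Q(1,2)]
  have g: "0 \<le> g i" if "i < n" for i
    using psd_adj_mult_self[OF X] Q(3) that by simp
  define q where "q i = inverse (sqrt (g i))" for i
  have qg: "sqrt (g i) * q i = (if g i = 0 then 0 else 1)" "q i * sqrt (g i) = (if g i = 0 then 0 else 1)" for i
    by (simp_all add: q_def)
  have q0: "g i = 0 \<Longrightarrow> q i = 0" for i by (simp add: q_def)
  define U where "U = X * ?F q"
  have U: "U \<in> carrier_mat n n" unfolding U_def by (auto intro!: carrier_matI)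
  have dU [simp]: "dim_row U = n" "dim_col U = n" using U by auto
  define P where "P = ?F (\<lambda>i. sqrt (g i))"
  define S where "S = ?F (\<lambda>i. sqrt (sqrt (g i)))"
  have adjU: "adj U = ?F q * adj X" unfolding U_def adj_mult[OF X Fc] by simp
  have UX: "adj U * X = P"
    unfolding adjU P_def using g
    by (simp add: mult_mat_assoc Q(3)) (auto intro!: F_cong simp: q_def real_div_sqrt field_simps)
  \<comment> \<open>The function on the right is the indicator of nonzero \<open>g i\<close>, so
    \<open>adj U * U\<close> projects onto the support of \<open>P\<close>.\<close>
  have UU: "adj U * U = ?F (\<lambda>i. sqrt (g i) * q i)"
  proof -
    have "adj U * U = adj U * X * ?F q" by (simp add: U_def mult_mat_assoc)
    then show ?thesis unfolding UX P_def by simp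
  qed
  have "adj U * U * S = S"
    unfolding UU S_def by (auto intro!: F_cong simp: qg)
  moreover have "U * adj U * (U * adj U) = U * adj U"
  proof -
    have "U * adj U * (U * adj U) = X * (?F q * (adj U * U)) * adj U"
      by (simp add: U_def mult_mat_assoc)
    \<comment> \<open>\<open>q\<close> vanishes where \<open>g\<close> does, so \<open>?F q\<close>
      absorbs the support projection; this makes \<open>U * adj U\<close> idempotent.\<close>
    also have "?F q * (adj U * U) = ?F q"
      unfolding UU by (auto intro!: F_cong simp: qg q0)
    finally show ?thesis by (simp add: U_def)
  qed
  moreover have "U * P = X"
  proof -
    \<comment> \<open>\<open>h\<close> is the indicator of the zeros of \<open>g\<close>. Since
      \<open>h i * g i * h i\<close> is 0, \<open>X * ?F h\<close> has Frobenius norm 0: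
      \<open>X\<close> vanishes on the kernel of \<open>P\<close>, and multiplying by the support
      projection does not change it.\<close>
    define h where "h i = 1 - q i * sqrt (g i)" for i
    have "adj (X * ?F h) * (X * ?F h) = ?F h * (adj X * X) * ?F h"
      unfolding adj_mult[OF X Fc] by (simp add: mult_mat_assoc)
    also have "\<dots> = ?F (\<lambda>i. 0)"
      unfolding Q(3) by (auto intro!: F_cong simp: h_def qg)
    also have "\<dots> = 0\<^sub>m n n"
    proof -
      have "diag_real n (\<lambda>_. 0) = 0\<^sub>m n n" by (rule eq_matI) (auto simp: diag_real_def)
      then show ?thesis using Q by (simp add: spectral_fun_def)
    qed
    finally have "mtrace (adj (X * ?F h) * (X * ?F h)) = 0" by (simp add: mtrace_def)
    then have 0: "X * ?F h = 0\<^sub>m n n"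
      using adj_mult_self_eq_zero[OF mult_carrier_mat[OF X Fc]] by simp
    have "?F h + ?F (\<lambda>i. q i * sqrt (g i)) = 1\<^sub>m n"
    proof -
      have "diag_real n h + diag_real n (\<lambda>i. q i * sqrt (g i)) = diag_real n (\<lambda>_. 1)"
        by (rule eq_matI) (auto simp: diag_real_def h_def simp flip: of_real_add)
      then have "?F h + ?F (\<lambda>i. q i * sqrt (g i)) = ?F (\<lambda>_. 1)"
        unfolding spectral_fun_def using Q
        by (simp add: mult_mat_distrib[symmetric])
      then show ?thesis using spectral_fun_one[OF Q(1,2)] by simp
    qed
    then have "X * (?F h + ?F (\<lambda>i. q i * sqrt (g i))) = X" using X by simp
    then have "X * ?F h + X * ?F (\<lambda>i. q i * sqrt (g i)) = X"
      by (simp add: mult_mat_distrib)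
    then have "X * ?F (\<lambda>i. q i * sqrt (g i)) = X" unfolding 0 using X Fc by (simp add: left_add_zero_mat[of _ n n])
    then show ?thesis by (simp add: U_def P_def mult_mat_assoc)
  qed
  moreover have "S * S = P" "P * P = adj X * X" "psd P" "psd S"
    using g unfolding S_def P_def Q(3) by (auto intro!: F_cong)
  ultimately show ?thesis using U UX Fc unfolding P_def S_def by blast
qed

section \<open>Trace norm\<close>

text \<open>For nonnegative eigenvalues the sum of squares is at most the square of the sum. Applied
  to the modulus of a matrix, it compares the Frobenius norm with the trace norm.\<close>

lemma psd_mtrace_square_le:
  assumes P: "P \<in> carrier_mat n n" "psd P"
  shows "Re (mtrace (P * P)) \<le> (Re (mtrace P))\<^sup>2"
proof -
  obtain Q f where Q: "Q \<in> carrier_mat n n" "adj Q * Q = 1\<^sub>m n" "P = spectral_fun Q f"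
    using hermitian_diagonalization[OF P(1) psdD_hermitian[OF P(2)]] by (auto simp: spectral_fun_def)
  have dQ [simp]: "dim_row Q = n" "dim_col Q = n" using Q by auto
  have f: "\<forall>i<n. 0 \<le> f i" using P Q(3) psd_spectral_fun_iff[OF Q(1,2)] by simp
  have tr: "Re (mtrace (spectral_fun Q g)) = (\<Sum>i<n. g i)" for g
  proof -
    have "mtrace (spectral_fun Q g) = mtrace (adj Q * (Q * diag_real n g))"
      unfolding spectral_fun_def using Q by (subst mtrace_mult_comm[of _ n n]) (auto intro!: carrier_matI)
    also have "adj Q * (Q * diag_real n g) = (adj Q * Q) * diag_real n g"
      by (simp add: mult_mat_assoc)
    finally show ?thesis unfolding Q(2) by (simp add: mtrace_def diag_real_def)
  qed
  have "(\<Sum>i<n. f i * f i) \<le> (\<Sum>i<n. f i * (\<Sum>j<n. f j))"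
    using f by (intro sum_mono mult_left_mono member_le_sum) auto
  then have "(\<Sum>i<n. f i * f i) \<le> (\<Sum>i<n. f i)\<^sup>2"
    by (simp add: sum_distrib_right power2_eq_square)
  then show ?thesis unfolding Q(3) spectral_fun_mult[OF Q(1,2)] tr .
qed

text \<open>An entry is bounded by the Frobenius norm, and that by the trace norm. Together with
  \<open>trace_norm_le_sum_entries\<close> it gives the crude estimates behind the finiteness of the
  diamond norm.\<close>

lemma entry_le_trace_norm:
  assumes X: "X \<in> carrier_mat n n" and ij: "i < n" "j < n"
  shows "cmod (X $$ (i,j)) \<le> trace_norm X"
proof -
  obtain P where P: "P \<in> carrier_mat n n" "psd P" "P * P = adj X * X"
    using polar_decomposition[OF X] by blast
  have tn: "trace_norm X = Re (mtrace P)" by (rule trace_norm_eq[OF X P])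
  have "(cmod (X $$ (i,j)))\<^sup>2 \<le> (\<Sum>l<n. (cmod (X $$ (l,j)))\<^sup>2)"
    using ij by (intro member_le_sum) auto
  also have "\<dots> \<le> (\<Sum>j<n. \<Sum>l<n. (cmod (X $$ (l,j)))\<^sup>2)"
    using ij by (intro member_le_sum[of j "{..<n}" "\<lambda>j. \<Sum>l<n. (cmod (X $$ (l,j)))\<^sup>2"]) (auto intro: sum_nonneg)
  also have "\<dots> = Re (mtrace (P * P))" unfolding P(3) mtrace_adj_mult_self[OF X] by simp
  also have "\<dots> \<le> (trace_norm X)\<^sup>2" unfolding tn by (rule psd_mtrace_square_le[OF P(1,2)])
  finally show ?thesis
    using psd_mtrace_nonneg[OF P(1,2)] unfolding tn by (rule power2_le_imp_le)
qed

text \<open>The trace norm is the trace of \<open>adj U * X\<close>, and the entries of the partial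
  isometry \<open>U\<close> have modulus at most 1 because \<open>U * adj U\<close> is an orthogonal
  projection.\<close>

lemma trace_norm_le_sum_entries:
  assumes X: "X \<in> carrier_mat n n"
  shows "trace_norm X \<le> (\<Sum>i<n. \<Sum>l<n. cmod (X $$ (l,i)))"
proof -
  obtain U P where U: "U \<in> carrier_mat n n" and P: "P \<in> carrier_mat n n" "psd P" "P * P = adj X * X"
    and UX: "adj U * X = P" and UU: "U * adj U * (U * adj U) = U * adj U"
    using polar_decomposition[OF X] by blast
  have U': "adj U \<in> carrier_mat n n" using U by simp
  define E where "E = U * adj U"
  have E: "E \<in> carrier_mat n n" unfolding E_def using mult_carrier_mat[OF U U'] .
  have EE: "E * E = E" using UU by (simp add: E_def)
  have adjE: "adj E = E" unfolding E_def using adj_mult[OF U U'] by simp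
  have U1: "cmod (U $$ (l,i)) \<le> 1" if li: "l < n" "i < n" for l i
  proof -
    \<comment> \<open>The squared length \<open>e\<close> of row \<open>l\<close> is the diagonal
      entry of \<open>E\<close>. Since \<open>E\<close> is Hermitian and idempotent, it is also the
      squared length of row \<open>l\<close> of \<open>E\<close>, hence at least
      \<open>e\<^sup>2\<close>; so \<open>e\<close> is at most 1.\<close>
    define e where "e = (\<Sum>i<n. (cmod (U $$ (l,i)))\<^sup>2)"
    have "E $$ (l,l) = (\<Sum>i<n. U $$ (l,i) * cnj (U $$ (l,i)))"
      unfolding E_def using li U U' by (subst index_mult_mat_sum[OF U U']) auto
    also have "\<dots> = complex_of_real e"
      unfolding e_def of_real_sum complex_norm_square ..
    finally have El: "E $$ (l,l) = complex_of_real e" .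
    have "(E * E) $$ (l,l) = (\<Sum>k<n. E $$ (l,k) * E $$ (k,l))"
      using li by (intro index_mult_mat_sum[OF E E])
    also have "\<dots> = (\<Sum>k<n. E $$ (l,k) * cnj (E $$ (l,k)))"
    proof (rule sum.cong[OF refl])
      fix k assume "k \<in> {..<n}"
      then have "E $$ (k,l) = cnj (E $$ (l,k))" using adj_index[of k E l] E li unfolding adjE by simp
      then show "E $$ (l,k) * E $$ (k,l) = E $$ (l,k) * cnj (E $$ (l,k))" by simp
    qed
    finally have "complex_of_real e = complex_of_real (\<Sum>k<n. (cmod (E $$ (l,k)))\<^sup>2)"
      unfolding EE El of_real_sum complex_norm_square .
    then have es: "e = (\<Sum>k<n. (cmod (E $$ (l,k)))\<^sup>2)" by (simp only: of_real_eq_iff)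
    have "(cmod (E $$ (l,l)))\<^sup>2 \<le> (\<Sum>k<n. (cmod (E $$ (l,k)))\<^sup>2)"
      using li by (intro member_le_sum) auto
    then have "e\<^sup>2 \<le> e" unfolding es[symmetric] El by simp
    then have "e * e \<le> e * 1" by (simp add: power2_eq_square)
    moreover have "0 \<le> e" unfolding e_def by (intro sum_nonneg) auto
    ultimately have "e \<le> 1" by (cases "e = 0") auto
    moreover have "(cmod (U $$ (l,i)))\<^sup>2 \<le> e"
      unfolding e_def using li by (intro member_le_sum) auto
    ultimately show ?thesis using power2_le_imp_le[of "cmod (U $$ (l,i))" 1] by simp
  qed
  have "trace_norm X = Re (mtrace (adj U * X))"
    unfolding UX by (rule trace_norm_eq[OF X P])
  also have "mtrace (adj U * X) = (\<Sum>i<n. \<Sum>l<n. cnj (U $$ (l,i)) * X $$ (l,i))"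
    using mtrace_carrier[OF mult_carrier_mat[OF U' X]] U X
    by (simp add: index_mult_mat_sum[OF U' X] del: index_mult_mat(1))
  also have "Re \<dots> \<le> cmod \<dots>" by (rule complex_Re_le_cmod)
  also have "\<dots> \<le> (\<Sum>i<n. \<Sum>l<n. cmod (cnj (U $$ (l,i)) * X $$ (l,i)))"
    by (intro sum_norm_le norm_sum)
  also have "\<dots> \<le> (\<Sum>i<n. \<Sum>l<n. cmod (X $$ (l,i)))"
    using U1 by (intro sum_mono) (auto simp: norm_mult intro!: mult_left_le_one_le)
  finally show ?thesis .
qed

text \<open>The squared Frobenius norm of \<open>U * S - S\<close> is twice
  \<open>Re (mtrace P) - Re (mtrace X)\<close>. The root \<open>S\<close> is used in place of
  \<open>P\<close> because the cross term \<open>mtrace (S * (U * S))\<close> then becomes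
  \<open>mtrace X\<close> by cyclicity.\<close>

lemma psd_if_trace_norm_le:
  assumes X: "X \<in> carrier_mat n n" and le: "trace_norm X \<le> Re (mtrace X)"
  shows "psd X"
proof -
  obtain U P S where U: "U \<in> carrier_mat n n" and P: "P \<in> carrier_mat n n" "psd P" "P * P = adj X * X"
    and S: "S \<in> carrier_mat n n" "psd S" "S * S = P"
    and UP: "U * P = X" and US: "adj U * U * S = S"
    using polar_decomposition[OF X] by blast
  have d [simp]: "dim_row U = n" "dim_col U = n" "dim_row P = n" "dim_col P = n" "dim_row S = n" "dim_col S = n"
    using U P S by auto
  have tn: "trace_norm X = Re (mtrace P)" by (rule trace_norm_eq[OF X P])
  have adjS: "adj S = S" by (rule psdD_hermitian[OF S(2)])
  have USc: "U * S \<in> carrier_mat n n" using mult_carrier_mat[OF U S(1)] .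
  define Y where "Y = U * S - S"
  have Y: "Y \<in> carrier_mat n n" unfolding Y_def by (auto intro!: carrier_matI)
  have adjUS: "adj (U * S) = S * adj U" using adj_mult[OF U S(1)] adjS by simp
  have adjY: "adj Y = S * adj U - S"
    unfolding Y_def using adj_minus[OF USc S(1)] adjS adjUS by simp
  have c: "S * adj U * S \<in> carrier_mat n n" "S * (U * S) \<in> carrier_mat n n"
    by (auto intro!: carrier_matI)
  have "adj Y * Y = (S * adj U - S) * (U * S - S)"
    unfolding adjY by (simp add: Y_def)
  also have "\<dots> = (S * adj U * (U * S) - S * (U * S)) - (S * adj U * S - S * S)"
    by (simp add: mult_mat_distrib)
  also have "S * adj U * (U * S) = P"
    using US S(3) by (simp add: mult_mat_assoc)
  finally have "mtrace (adj Y * Y) = (mtrace P - mtrace (S * (U * S))) - (mtrace (S * adj U * S) - mtrace P)"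
    unfolding S(3) using c P by (simp add: mtrace_minus[of _ n] minus_carrier_mat[of _ n n])
  moreover have "mtrace (S * (U * S)) = mtrace X"
    using mtrace_mult_comm[OF S(1) USc] UP S(3) by (simp add: mult_mat_assoc)
  moreover have "mtrace (S * adj U * S) = cnj (mtrace (S * (U * S)))"
    using mtrace_adj[OF c(2)] adj_mult[OF S(1) USc] adjUS adjS by simp
  ultimately have "Re (mtrace (adj Y * Y)) \<le> 0" using le tn by simp
  from adj_mult_self_eq_zero[OF Y this] have "Y = 0\<^sub>m n n" .
  then have "(U * S - S) $$ (i,j) = 0" if "i < n" "j < n" for i j using that unfolding Y_def by simp
  then have "U * S = S" by (intro eq_matI) (auto simp del: index_mult_mat(1))
  then have "U * P = P" unfolding S(3)[symmetric] by (simp add: mult_mat_assoc[symmetric])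
  then show ?thesis using UP P by simp
qed

text \<open>This is the trace of the block matrix compressed by the block column with entries
  \<open>B1\<close> and \<open>B2\<close>, padded with zero columns to stay square. Suitable choices
  of the two blocks extract trace inequalities.\<close>

lemma mtrace_block_congruence_nonneg:
  assumes A: "A \<in> carrier_mat n n" and X: "X \<in> carrier_mat n n" and Z: "Z \<in> carrier_mat n n" and C: "C \<in> carrier_mat n n"
    and psd: "psd (four_block_mat A X Z C)"
    and B1: "B1 \<in> carrier_mat n n" and B2: "B2 \<in> carrier_mat n n"
  shows "0 \<le> Re (mtrace (adj B1 * A * B1) + mtrace (adj B2 * Z * B1)
    + (mtrace (adj B1 * X * B2) + mtrace (adj B2 * C * B2)))"
proof -
  have d [simp]: "dim_row A = n" "dim_col A = n" "dim_row X = n" "dim_col X = n" "dim_row Z = n" "dim_col Z = n"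
    "dim_row C = n" "dim_col C = n" "dim_row B1 = n" "dim_col B1 = n" "dim_row B2 = n" "dim_col B2 = n"
    using A X Z C B1 B2 by auto
  define B where "B = four_block_mat B1 (0\<^sub>m n n) B2 (0\<^sub>m n n)"
  define M where "M = four_block_mat A X Z C"
  have B: "B \<in> carrier_mat (n+n) (n+n)" unfolding B_def by (rule four_block_carrier_mat[OF B1 zero_carrier_mat])
  have M: "M \<in> carrier_mat (n+n) (n+n)" unfolding M_def by (rule four_block_carrier_mat[OF A C])
  have adjB: "adj B = four_block_mat (adj B1) (adj B2) (0\<^sub>m n n) (0\<^sub>m n n)"
    unfolding B_def using adj_four_block_mat[OF B1 zero_carrier_mat B2 zero_carrier_mat] by simp
  have BM: "adj B * M = four_block_mat (adj B1 * A + adj B2 * Z) (adj B1 * X + adj B2 * C)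
      (0\<^sub>m n n * A + 0\<^sub>m n n * Z) (0\<^sub>m n n * X + 0\<^sub>m n n * C)"
    unfolding adjB M_def
    by (rule mult_four_block_mat[OF adj_carrier[OF B1] adj_carrier[OF B2] zero_carrier_mat zero_carrier_mat A X Z C])
  have "adj B * M * B = four_block_mat
      ((adj B1 * A + adj B2 * Z) * B1 + (adj B1 * X + adj B2 * C) * B2)
      ((adj B1 * A + adj B2 * Z) * 0\<^sub>m n n + (adj B1 * X + adj B2 * C) * 0\<^sub>m n n)
      ((0\<^sub>m n n * A + 0\<^sub>m n n * Z) * B1 + (0\<^sub>m n n * X + 0\<^sub>m n n * C) * B2)
      ((0\<^sub>m n n * A + 0\<^sub>m n n * Z) * 0\<^sub>m n n + (0\<^sub>m n n * X + 0\<^sub>m n n * C) * 0\<^sub>m n n)" (is "_ = four_block_mat ?Y _ _ ?O")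
    unfolding BM unfolding B_def
    by (rule mult_four_block_mat[OF _ _ _ _ B1 zero_carrier_mat B2 zero_carrier_mat]) (auto intro!: carrier_matI)
  moreover have "?Y \<in> carrier_mat n n" "?O \<in> carrier_mat n n" by (auto intro!: carrier_matI)
  ultimately have "mtrace (adj B * M * B) = mtrace ?Y + mtrace ?O"
    using mtrace_four_block_mat by simp
  moreover have "mtrace ?O = 0" unfolding mtrace_def by (auto intro!: sum.neutral)
  moreover have "?Y = (adj B1 * A * B1 + adj B2 * Z * B1) + (adj B1 * X * B2 + adj B2 * C * B2)"
    by (simp add: mult_mat_distrib)
  moreover have "mtrace ((adj B1 * A * B1 + adj B2 * Z * B1) + (adj B1 * X * B2 + adj B2 * C * B2))
     = mtrace (adj B1 * A * B1) + mtrace (adj B2 * Z * B1) + (mtrace (adj B1 * X * B2) + mtrace (adj B2 * C * B2))"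
  proof -
    have c: "adj B1 * A * B1 \<in> carrier_mat n n" "adj B2 * Z * B1 \<in> carrier_mat n n"
      "adj B1 * X * B2 \<in> carrier_mat n n" "adj B2 * C * B2 \<in> carrier_mat n n"
      by (auto intro!: carrier_matI)
    show ?thesis
      unfolding mtrace_add[OF add_carrier_mat[OF c(2)] add_carrier_mat[OF c(4)]]
        mtrace_add[OF c(1,2)] mtrace_add[OF c(3,4)] ..
  qed
  moreover have "0 \<le> Re (mtrace (adj B * M * B))"
    by (rule psd_mtrace_nonneg[OF mult_carrier_mat[OF mult_carrier_mat[OF adj_carrier[OF B] M] B]
          psd_congruence[OF M psd[folded M_def] B]])
  ultimately show ?thesis by simp
qed

text \<open>Testing with the block column of \<open>T\<close> and \<open>- 1\<^sub>m n\<close>,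
  where \<open>T\<close> is the polar isometry of \<open>X\<close>, bounds twice the trace norm by
  the traces of \<open>adj T * A * T\<close> and \<open>C\<close>. Testing with the complementary
  projection \<open>G\<close> and 0 shows that compressing \<open>A\<close> by \<open>T\<close> does
  not increase its trace.\<close>

lemma trace_norm_off_diagonal_block_le:
  assumes A: "A \<in> carrier_mat n n" and X: "X \<in> carrier_mat n n" and Z: "Z \<in> carrier_mat n n" and C: "C \<in> carrier_mat n n"
    and psd: "psd (four_block_mat A X Z C)"
  shows "trace_norm X \<le> (Re (mtrace A) + Re (mtrace C)) / 2"
proof -
  obtain T K where T: "T \<in> carrier_mat n n" and K: "K \<in> carrier_mat n n" "psd K" "K * K = adj X * X"
    and TX: "adj T * X = K" and TT: "T * adj T * (T * adj T) = T * adj T"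
    using polar_decomposition[OF X] by blast
  have d [simp]: "dim_row A = n" "dim_col A = n" "dim_row X = n" "dim_col X = n" "dim_row Z = n" "dim_col Z = n"
    "dim_row C = n" "dim_col C = n" "dim_row T = n" "dim_col T = n" "dim_row K = n" "dim_col K = n"
    using A X Z C T K by auto
  have T': "adj T \<in> carrier_mat n n" using T by simp
  have tn: "trace_norm X = Re (mtrace K)" by (rule trace_norm_eq[OF X K])
  \<comment> \<open>A positive block matrix is Hermitian, which determines the lower left
    block.\<close>
  have ZX: "Z = adj X"
  proof (rule eq_matI)
    fix i j assume "i < dim_row (adj X)" "j < dim_col (adj X)"
    then have ij: "i < n" "j < n" by auto
    have "adj (four_block_mat A X Z C) $$ (n + i, j) = four_block_mat A X Z C $$ (n + i, j)"
      using psdD_hermitian[OF psd] by simp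
    then show "Z $$ (i,j) = adj X $$ (i,j)" using ij by simp
  qed auto
  define E where "E = T * adj T"
  \<comment> \<open>The trace of \<open>adj G * A * G\<close> is exactly what \<open>A\<close> loses
    in trace under compression by \<open>T\<close>.\<close>
  define G where "G = 1\<^sub>m n - E"
  have E: "E \<in> carrier_mat n n" and G: "G \<in> carrier_mat n n"
    unfolding E_def G_def by (auto intro!: carrier_matI)
  have dE [simp]: "dim_row E = n" "dim_col E = n" "dim_row G = n" "dim_col G = n" using E G by auto
  have adjE: "adj E = E" unfolding E_def using adj_mult[OF T T'] by simp
  have adjG: "adj G = G" unfolding G_def using adj_minus[OF one_carrier_mat E] adjE by simp
  have EE: "E * E = E" using TT unfolding E_def .
  have GG: "G * G = G"
  proof -
    have "G * G = (1\<^sub>m n * 1\<^sub>m n - 1\<^sub>m n * E) - (E * 1\<^sub>m n - E * E)"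
      unfolding G_def by (simp add: mult_mat_distrib)
    also have "\<dots> = G" unfolding EE G_def using E by (intro eq_matI) auto
    finally show ?thesis .
  qed
  have AG: "A * G \<in> carrier_mat n n" and AE: "A * E \<in> carrier_mat n n" by (auto intro!: carrier_matI)
  have "mtrace (adj G * A * G) = mtrace (A * G)"
    using mtrace_mult_comm[OF G AG] GG adjG by (simp add: mult_mat_assoc)
  also have "A * G = A - A * E" unfolding G_def using A by (simp add: mult_mat_distrib)
  also have "mtrace \<dots> = mtrace A - mtrace (A * E)" by (rule mtrace_minus[OF A AE])
  also have "mtrace (A * E) = mtrace (adj T * A * T)"
    using mtrace_mult_comm[of "A * T" n n "adj T"] T A by (auto simp: E_def mult_mat_assoc intro!: carrier_matI)
  finally have trG: "mtrace (adj G * A * G) = mtrace A - mtrace (adj T * A * T)" .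
  have z: "mtrace (0\<^sub>m n n) = 0" by (simp add: mtrace_def)
  have "0 \<le> Re (mtrace (adj G * A * G))"
  proof -
    have "adj G * X * 0\<^sub>m n n = 0\<^sub>m n n" "0\<^sub>m n n * Z * G = 0\<^sub>m n n" "0\<^sub>m n n * C * 0\<^sub>m n n = 0\<^sub>m n n"
      using X Z C G by (simp_all add: mult_mat_assoc right_mult_zero_mat[of _ n n] left_mult_zero_mat[of _ n n])
    then show ?thesis
      using mtrace_block_congruence_nonneg[OF A X Z C psd G zero_carrier_mat] by (simp add: z)
  qed
  then have 1: "Re (mtrace (adj T * A * T)) \<le> Re (mtrace A)" unfolding trG by simp
  \<comment> \<open>The minus sign gives both cross terms real part minus the trace norm of
    \<open>X\<close>.\<close>
  have m1: "- 1\<^sub>m n \<in> carrier_mat n n" by simp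
  have "adj (- 1\<^sub>m n) * Z * T = - (adj X * T)"
    unfolding ZX adj_uminus by (auto intro!: eq_matI)
  moreover have "adj X * T = adj K" using adj_mult[OF T' X] TX by simp
  ultimately have "mtrace (adj (- 1\<^sub>m n) * Z * T) = - cnj (mtrace K)"
    using mtrace_adj[OF K(1)] by (simp add: mtrace_def sum_negf)
  moreover have "adj T * X * (- 1\<^sub>m n) = - K"
    unfolding TX using K(1) by (auto intro!: eq_matI)
  then have "mtrace (adj T * X * (- 1\<^sub>m n)) = - mtrace K" by (simp add: mtrace_def sum_negf)
  moreover have "adj (- 1\<^sub>m n) * C * (- 1\<^sub>m n) = C"
    unfolding adj_uminus using C by (auto intro!: eq_matI)
  ultimately have "0 \<le> Re (mtrace (adj T * A * T) - cnj (mtrace K) + (- mtrace K + mtrace C))"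
    using mtrace_block_congruence_nonneg[OF A X Z C psd T m1] by simp
  then show ?thesis using 1 tn by simp
qed

text \<open>With \<open>V = U * S\<close> the block matrix is \<open>adj R * R\<close> for the block
  row \<open>R\<close> of \<open>adj V\<close> and \<open>S\<close>, since
  \<open>V * S = U * P = W\<close>. By cyclicity both diagonal blocks have the trace of
  \<open>P\<close>.\<close>

lemma psd_block_dilation:
  assumes W: "W \<in> carrier_mat n n"
  shows "\<exists>A C. A \<in> carrier_mat n n \<and> C \<in> carrier_mat n n \<and> psd (four_block_mat A W (adj W) C) \<and>
    Re (mtrace A) = trace_norm W \<and> Re (mtrace C) = trace_norm W"
proof -
  obtain U P S where U: "U \<in> carrier_mat n n" and P: "P \<in> carrier_mat n n" "psd P" "P * P = adj W * W"
    and S: "S \<in> carrier_mat n n" "psd S" "S * S = P"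
    and UP: "U * P = W" and US: "adj U * U * S = S"
    using polar_decomposition[OF W] by blast
  have d [simp]: "dim_row U = n" "dim_col U = n" "dim_row P = n" "dim_col P = n" "dim_row S = n" "dim_col S = n"
    using U P S by auto
  have tn: "trace_norm W = Re (mtrace P)" by (rule trace_norm_eq[OF W P])
  have adjS: "adj S = S" by (rule psdD_hermitian[OF S(2)])
  define V where "V = U * S"
  have V: "V \<in> carrier_mat n n" unfolding V_def using mult_carrier_mat[OF U S(1)] .
  have dV [simp]: "dim_row V = n" "dim_col V = n" using V by auto
  have adjV: "adj V = S * adj U" unfolding V_def using adj_mult[OF U S(1)] adjS by simp
  have VS: "V * S = W" using UP S(3) by (simp add: V_def mult_mat_assoc)
  have SV: "S * adj V = adj W" using adj_mult[OF V S(1)] VS adjS by simp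
  define R where "R = four_block_mat (adj V) S (0\<^sub>m n n) (0\<^sub>m n n)"
  have R: "R \<in> carrier_mat (n+n) (n+n)" unfolding R_def using four_block_carrier_mat[OF adj_carrier[OF V] zero_carrier_mat] .
  have adjR: "adj R = four_block_mat V (0\<^sub>m n n) S (0\<^sub>m n n)"
    unfolding R_def using adj_four_block_mat[OF adj_carrier[OF V] S(1) zero_carrier_mat zero_carrier_mat] adjS by simp
  have "adj R * R = four_block_mat (V * adj V + 0\<^sub>m n n * 0\<^sub>m n n) (V * S + 0\<^sub>m n n * 0\<^sub>m n n)
      (S * adj V + 0\<^sub>m n n * 0\<^sub>m n n) (S * S + 0\<^sub>m n n * 0\<^sub>m n n)"
    unfolding adjR unfolding R_def
    by (rule mult_four_block_mat[OF V zero_carrier_mat S(1) zero_carrier_mat adj_carrier[OF V] S(1) zero_carrier_mat zero_carrier_mat])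
  also have "\<dots> = four_block_mat (V * adj V) W (adj W) P"
    unfolding VS SV S(3) using V W P adj_carrier[OF W] mult_carrier_mat[OF V adj_carrier[OF V]] by simp
  finally have "psd (four_block_mat (V * adj V) W (adj W) P)"
    using psd_adj_mult_self[OF R] by simp
  moreover have "mtrace (V * adj V) = mtrace P"
  proof -
    have "mtrace (V * adj V) = mtrace (adj V * V)" by (rule mtrace_mult_comm[OF V adj_carrier[OF V]])
    also have "adj V * V = S * (adj U * U * S)" unfolding adjV by (simp add: V_def mult_mat_assoc)
    finally show ?thesis unfolding US S(3) .
  qed
  ultimately show ?thesis using tn P(1) mult_carrier_mat[OF V adj_carrier[OF V]] by metis
qed

section \<open>Amplified maps and the Choi matrix\<close>

lemma sum_lessThan_mult:
  fixes f :: "nat \<Rightarrow> 'a::comm_monoid_add"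
  shows "(\<Sum>a<n*d. f a) = (\<Sum>i<n. \<Sum>k<d. f (i*d+k))"
proof (induction n)
  case (Suc n)
  have "(\<Sum>a<Suc n * d. f a) = (\<Sum>a<n*d + d. f a)" by (simp add: add.commute)
  then show ?case using Suc by (simp add: sum_lessThan_add)
qed simp

lemma block_index_less:
  fixes i k n d :: nat
  assumes "i < n" "k < d"
  shows "i * d + k < n * d"
proof -
  have "i * d + k < Suc i * d" using assms by simp
  also have "\<dots> \<le> n * d" using assms by (intro mult_le_mono1) simp
  finally show ?thesis .
qed

lemma block_index_cases:
  fixes a n d :: nat
  assumes "a < n * d"
  obtains i k where "i < n" "k < d" "a = i * d + k"
proof
  show "a div d < n" using assms by (simp add: less_mult_imp_div_less)
  show "a mod d < d" using assms by (cases d) auto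
qed simp

definition block :: "nat \<Rightarrow> complex mat \<Rightarrow> nat \<Rightarrow> nat \<Rightarrow> complex mat" where
  "block d W i j = mat d d (\<lambda>(k,l). W $$ (i*d+k, j*d+l))"

lemma block_carrier [simp]: "block d W i j \<in> carrier_mat d d"
  by (simp add: block_def)

lemma block_dim [simp]: "dim_row (block d W i j) = d" "dim_col (block d W i j) = d"
  by (simp_all add: block_def)

lemma block_index [simp]: "k < d \<Longrightarrow> l < d \<Longrightarrow> block d W i j $$ (k,l) = W $$ (i*d+k, j*d+l)"
  by (simp add: block_def)

lemma ampl_carrier [simp]: "ampl n d L W \<in> carrier_mat (n*d) (n*d)"
  by (simp add: ampl_def)

lemma ampl_dim [simp]: "dim_row (ampl n d L W) = n*d" "dim_col (ampl n d L W) = n*d"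
  by (simp_all add: ampl_def)

lemma ampl_index:
  assumes "i < n" "j < n" "k < d" "l < d"
  shows "ampl n d L W $$ (i*d+k, j*d+l) = L (block d W i j) $$ (k,l)"
  using assms block_index_less[of i n k d] block_index_less[of j n l d]
  by (simp add: ampl_def block_def)

lemma block_eqI:
  assumes "A \<in> carrier_mat (n*d) (n*d)" "B \<in> carrier_mat (n*d) (n*d)"
    and "\<And>i j k l. i < n \<Longrightarrow> j < n \<Longrightarrow> k < d \<Longrightarrow> l < d \<Longrightarrow> A $$ (i*d+k, j*d+l) = B $$ (i*d+k, j*d+l)"
  shows "A = B"
proof (rule eq_matI)
  fix a b assume "a < dim_row B" "b < dim_col B"
  then have "a < n * d" "b < n * d" using assms by auto
  then show "A $$ (a,b) = B $$ (a,b)" using assms(3) by (metis block_index_cases)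
qed (use assms in auto)

lemma block_ampl:
  assumes "\<And>A. A \<in> carrier_mat d d \<Longrightarrow> L A \<in> carrier_mat d d" "i < n" "j < n"
  shows "block d (ampl n d L W) i j = L (block d W i j)"
  using assms(1)[OF block_carrier, of W i j] assms(2,3)
  by (intro eq_matI) (auto simp: ampl_index)

text \<open>\<open>L'\<close> has to match the composite only on the carrier. It can therefore be
  the identity when \<open>V\<close> is an \<open>inv_into\<close>, which is controlled only
  there.\<close>

lemma ampl_ampl:
  assumes "\<And>A. A \<in> carrier_mat d d \<Longrightarrow> L A \<in> carrier_mat d d"
    and "\<And>A. A \<in> carrier_mat d d \<Longrightarrow> V (L A) = L' A"
  shows "ampl n d V (ampl n d L W) = ampl n d L' W"
  by (rule block_eqI[of _ n d]) (simp_all add: ampl_index block_ampl[OF assms(1)] assms(2))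

lemma ampl_ident:
  assumes "W \<in> carrier_mat (n*d) (n*d)" "\<And>A. A \<in> carrier_mat d d \<Longrightarrow> L A = A"
  shows "ampl n d L W = W"
  using assms(1) by (intro block_eqI[of _ n d]) (simp_all add: ampl_index assms(2))

lemma mtrace_ampl:
  assumes "trace_preserving d L" "\<And>A. A \<in> carrier_mat d d \<Longrightarrow> L A \<in> carrier_mat d d"
    and W: "W \<in> carrier_mat (n*d) (n*d)"
  shows "mtrace (ampl n d L W) = mtrace W"
proof -
  have "mtrace (ampl n d L W) = (\<Sum>i<n. \<Sum>k<d. L (block d W i i) $$ (k,k))"
    by (simp add: mtrace_def sum_lessThan_mult ampl_index)
  also have "\<dots> = (\<Sum>i<n. mtrace (L (block d W i i)))"
    using assms(2)[OF block_carrier] by (intro sum.cong refl) (simp add: mtrace_carrier[of _ d])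
  also have "\<dots> = (\<Sum>i<n. mtrace (block d W i i))"
    using assms(1) by (simp add: trace_preserving_def)
  also have "\<dots> = (\<Sum>i<n. \<Sum>k<d. W $$ (i*d+k,i*d+k))"
    by (intro sum.cong refl) (simp add: mtrace_carrier[OF block_carrier])
  also have "\<dots> = mtrace W" using W by (simp add: mtrace_carrier[OF W] sum_lessThan_mult)
  finally show ?thesis .
qed

text \<open>The outer tensor index is the more significant one, so the first \<open>n\<close> of
  \<open>n+n\<close> outer indices fill exactly the upper half. A two-by-two block matrix is thus an
  element of the tensor product at level \<open>n+n\<close>.\<close>

lemma ampl_four_block_mat:
  assumes A: "A \<in> carrier_mat (n*d) (n*d)" and X: "X \<in> carrier_mat (n*d) (n*d)"
    and Z: "Z \<in> carrier_mat (n*d) (n*d)" and C: "C \<in> carrier_mat (n*d) (n*d)"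
  shows "ampl (n+n) d L (four_block_mat A X Z C)
    = four_block_mat (ampl n d L A) (ampl n d L X) (ampl n d L Z) (ampl n d L C)"
proof (rule block_eqI[of _ "n+n" d])
  let ?M = "four_block_mat A X Z C"
  let ?N = "four_block_mat (ampl n d L A) (ampl n d L X) (ampl n d L Z) (ampl n d L C)"
  \<comment> \<open>The outer index \<open>m\<close> alone decides the half, and passing to the
    second half lowers it by \<open>n\<close> without touching \<open>k\<close>.\<close>
  have idx: "(m*d+k < n*d) = (m < n)" "\<not> m < n \<Longrightarrow> m*d+k - n*d = (m-n)*d+k" if "k < d" for m k
  proof -
    show "(m*d+k < n*d) = (m < n)"
    proof
      assume "m*d+k < n*d"
      then have "m * d < n * d" by linarith
      then show "m < n" by simp
    qed (use block_index_less that in blast)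
    show "\<not> m < n \<Longrightarrow> m*d+k - n*d = (m-n)*d+k"
      by (simp add: diff_mult_distrib not_less mult_le_mono1)
  qed
  have M: "?M $$ (a,b) = (if a < n*d then if b < n*d then A $$ (a,b) else X $$ (a,b-n*d)
      else if b < n*d then Z $$ (a-n*d,b) else C $$ (a-n*d,b-n*d))" if "a < (n+n)*d" "b < (n+n)*d" for a b
    using A X Z C that by (simp add: add_mult_distrib)
  fix i j k l assume ij: "i < n+n" "j < n+n" and kl: "k < d" "l < d"
  have blk: "block d ?M i j = (if i < n then if j < n then block d A i j else block d X i (j-n)
      else if j < n then block d Z (i-n) j else block d C (i-n) (j-n))" (is "_ = ?b")
  proof (rule eq_matI)
    fix a b assume "a < dim_row ?b" "b < dim_col ?b"
    then have "a < d" "b < d" by (simp_all split: if_splits)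
    then show "block d ?M i j $$ (a,b) = ?b $$ (a,b)"
      using ij by (simp add: M block_index_less idx del: index_mat_four_block)
  qed simp_all
  have "?N $$ (i*d+k,j*d+l) = (if i < n then if j < n then ampl n d L A $$ (i*d+k,j*d+l) else ampl n d L X $$ (i*d+k,(j-n)*d+l)
      else if j < n then ampl n d L Z $$ ((i-n)*d+k,j*d+l) else ampl n d L C $$ ((i-n)*d+k,(j-n)*d+l))"
    using block_index_less[OF ij(1) kl(1)] block_index_less[OF ij(2) kl(2)] kl
    by (simp add: idx add_mult_distrib)
  then show "ampl (n+n) d L ?M $$ (i*d+k,j*d+l) = ?N $$ (i*d+k,j*d+l)"
    using ij kl by (simp add: ampl_index blk)
next
  show "four_block_mat (ampl n d L A) (ampl n d L X) (ampl n d L Z) (ampl n d L C) \<in> carrier_mat ((n+n)*d) ((n+n)*d)"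
    using four_block_carrier_mat[OF ampl_carrier[of n d L A] ampl_carrier[of n d L C]] by (simp add: add_mult_distrib)
qed simp

text \<open>Complete positivity enters at the doubled level \<open>n+n\<close>, where the dilation
  of \<open>W\<close> lives.\<close>

theorem cptp_trace_norm_contraction:
  assumes L: "cptp d L" and W: "W \<in> carrier_mat (n*d) (n*d)"
  shows "trace_norm (ampl n d L W) \<le> trace_norm W"
proof -
  have tp: "trace_preserving d L" and cp: "completely_positive d L"
    and Lc: "\<And>A. A \<in> carrier_mat d d \<Longrightarrow> L A \<in> carrier_mat d d"
    using L by (auto simp: cptp_def linear_map_on_def)
  obtain A C where A: "A \<in> carrier_mat (n*d) (n*d)" and C: "C \<in> carrier_mat (n*d) (n*d)"
    and psd: "psd (four_block_mat A W (adj W) C)"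
    and tr: "Re (mtrace A) = trace_norm W" "Re (mtrace C) = trace_norm W"
    using psd_block_dilation[OF W] by blast
  have "four_block_mat A W (adj W) C \<in> carrier_mat ((n+n)*d) ((n+n)*d)"
    using four_block_carrier_mat[OF A C] by (simp add: add_mult_distrib)
  then have "psd (ampl (n+n) d L (four_block_mat A W (adj W) C))"
    using cp psd by (auto simp: completely_positive_def)
  then have "psd (four_block_mat (ampl n d L A) (ampl n d L W) (ampl n d L (adj W)) (ampl n d L C))"
    using ampl_four_block_mat[OF A W adj_carrier[OF W] C] by simp
  from trace_norm_off_diagonal_block_le[OF ampl_carrier ampl_carrier ampl_carrier ampl_carrier this]
  show ?thesis by (simp add: mtrace_ampl[OF tp Lc A] mtrace_ampl[OF tp Lc C] tr)
qed

text \<open>The projection onto the normalised sum of the vectors e_i tensor e_i: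
  \<open>a div d = a mod d\<close> holds exactly for the indices of these product vectors, and the
  factor makes the trace 1.\<close>

definition max_ent :: "nat \<Rightarrow> complex mat" where
  "max_ent d = mat (d*d) (d*d)
     (\<lambda>(a,b). if a div d = a mod d \<and> b div d = b mod d then 1 / of_nat d else 0)"

lemma max_ent_carrier [simp]: "max_ent d \<in> carrier_mat (d*d) (d*d)"
  by (simp add: max_ent_def)

lemma max_ent_index:
  assumes "i < d" "j < d" "k < d" "l < d"
  shows "max_ent d $$ (i*d+k, j*d+l) = (if i = k \<and> j = l then 1 / of_nat d else 0)"
  using assms block_index_less[of i d k d] block_index_less[of j d l d]
  by (simp add: max_ent_def)

lemma psd_max_ent: "psd (max_ent d)"
proof -
  define B where "B = mat 1 (d*d) (\<lambda>(_,b). if b div d = b mod d then complex_of_real (1 / sqrt d) else 0)"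
  have B: "B \<in> carrier_mat 1 (d*d)" by (simp add: B_def)
  have "adj B * B = max_ent d"
  proof (rule eq_matI)
    fix a b assume "a < dim_row (max_ent d)" "b < dim_col (max_ent d)"
    then have ab: "a < d*d" "b < d*d" by (auto simp: max_ent_def)
    have "(adj B * B) $$ (a,b) = cnj (B $$ (0,a)) * B $$ (0,b)"
      using ab index_mult_mat_sum[OF adj_carrier[OF B] B ab] B by simp
    then show "(adj B * B) $$ (a,b) = max_ent d $$ (a,b)"
      using ab by (simp add: B_def max_ent_def flip: of_real_mult)
  qed (use B in \<open>auto simp: max_ent_def\<close>)
  then show ?thesis using psd_adj_mult_self[OF B] by simp
qed

lemma mtrace_max_ent: "d > 0 \<Longrightarrow> mtrace (max_ent d) = 1"
  by (simp add: mtrace_carrier[OF max_ent_carrier] sum_lessThan_mult max_ent_index)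

lemma trace_norm_max_ent: "d > 0 \<Longrightarrow> trace_norm (max_ent d) = 1"
  by (simp add: trace_norm_psd[OF max_ent_carrier psd_max_ent] mtrace_max_ent)

text \<open>Expansion in matrix units. It makes a linear map a finite table of numbers, from which
  the Choi matrix is read off.\<close>

lemma linear_map_on_index:
  assumes L: "linear_map_on d L" and A: "A \<in> carrier_mat d d" and kl: "k < d" "l < d"
  shows "L A $$ (k,l) = (\<Sum>p<d. \<Sum>q<d. A $$ (p,q) * L (mat d d (\<lambda>x. if x = (p,q) then 1 else 0)) $$ (k,l))"
proof -
  let ?E = "\<lambda>x. mat d d (\<lambda>y. if y = x then 1 else 0) :: complex mat"
  have Lc: "L B \<in> carrier_mat d d" if "B \<in> carrier_mat d d" for B
    using L that by (auto simp: linear_map_on_def)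
  have add: "L (B + B') = L B + L B'" if "B \<in> carrier_mat d d" "B' \<in> carrier_mat d d" for B B'
    using L that unfolding linear_map_on_def by blast
  have smult: "L (c \<cdot>\<^sub>m B) = c \<cdot>\<^sub>m L B" if "B \<in> carrier_mat d d" for c B
    using L that unfolding linear_map_on_def by blast
  \<comment> \<open>Induction over the set of positions at which \<open>A\<close> is kept, because
    linearity is available for binary sums only; the empty case uses the scalar 0.\<close>
  have "finite S \<Longrightarrow> S \<subseteq> {..<d} \<times> {..<d} \<Longrightarrow>
    L (mat d d (\<lambda>x. if x \<in> S then A $$ x else 0)) $$ (k,l) = (\<Sum>x\<in>S. A $$ x * L (?E x) $$ (k,l))" for S
  proof (induction S rule: finite_induct)
    case empty
    have "mat d d (\<lambda>x. if x \<in> {} then A $$ x else 0) = 0 \<cdot>\<^sub>m A"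
      using A by (intro eq_matI) auto
    moreover have "L (0 \<cdot>\<^sub>m A) = 0 \<cdot>\<^sub>m L A" by (rule smult[OF A])
    ultimately show ?case using Lc[OF A] kl by simp
  next
    case (insert x S)
    have "mat d d (\<lambda>y. if y \<in> insert x S then A $$ y else 0)
      = A $$ x \<cdot>\<^sub>m ?E x + mat d d (\<lambda>y. if y \<in> S then A $$ y else 0)"
      using insert.hyps by (intro eq_matI) auto
    also have "L \<dots> = L (A $$ x \<cdot>\<^sub>m ?E x) + L (mat d d (\<lambda>y. if y \<in> S then A $$ y else 0))"
      by (rule add[OF smult_carrier_mat[OF mat_carrier] mat_carrier])
    also have "L (A $$ x \<cdot>\<^sub>m ?E x) = A $$ x \<cdot>\<^sub>m L (?E x)"
      by (rule smult[OF mat_carrier])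
    finally show ?case
      using insert kl Lc[OF mat_carrier, of "\<lambda>y. if y = x then 1 else 0"]
        Lc[OF mat_carrier, of "\<lambda>y. if y \<in> S then A $$ y else 0"] by simp
  qed
  from this[of "{..<d} \<times> {..<d}"]
  have "L (mat d d (\<lambda>x. if x \<in> {..<d} \<times> {..<d} then A $$ x else 0)) $$ (k,l)
    = (\<Sum>x\<in>{..<d} \<times> {..<d}. A $$ x * L (?E x) $$ (k,l))" by simp
  moreover have "mat d d (\<lambda>x. if x \<in> {..<d} \<times> {..<d} then A $$ x else 0) = A"
    using A by (intro eq_matI) auto
  ultimately show ?thesis by (simp add: sum.cartesian_product)
qed

text \<open>\<open>ampl d d L (max_ent d)\<close> is the Choi matrix of \<open>L\<close> divided by \<open>d\<close>.\<close>

lemma ampl_choi_index: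
  assumes L: "linear_map_on d L" and ij: "i < n" "j < n" and kl: "k < d" "l < d"
  shows "ampl n d L W $$ (i*d+k, j*d+l)
    = of_nat d * (\<Sum>p<d. \<Sum>q<d. W $$ (i*d+p, j*d+q) * ampl d d L (max_ent d) $$ (p*d+k, q*d+l))"
proof -
  have choi: "ampl d d L (max_ent d) $$ (p*d+k, q*d+l)
      = (1 / of_nat d) * L (mat d d (\<lambda>x. if x = (p,q) then 1 else 0)) $$ (k,l)" if pq: "p < d" "q < d" for p q
  proof -
    let ?E = "mat d d (\<lambda>x. if x = (p,q) then 1 else 0) :: complex mat"
    have "block d (max_ent d) p q = (1 / of_nat d) \<cdot>\<^sub>m ?E"
      using pq by (intro eq_matI) (auto simp: max_ent_index block_def)
    moreover have "L ((1 / of_nat d) \<cdot>\<^sub>m ?E) = (1 / of_nat d) \<cdot>\<^sub>m L ?E"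
      using L mat_carrier[of d d "\<lambda>x. if x = (p,q) then 1 else 0"] unfolding linear_map_on_def by blast
    moreover have "L ?E \<in> carrier_mat d d"
      using L mat_carrier[of d d "\<lambda>x. if x = (p,q) then 1 else 0"] unfolding linear_map_on_def by blast
    ultimately show ?thesis using pq kl by (simp add: ampl_index)
  qed
  have "ampl n d L W $$ (i*d+k, j*d+l)
      = (\<Sum>p<d. \<Sum>q<d. W $$ (i*d+p, j*d+q) * L (mat d d (\<lambda>x. if x = (p,q) then 1 else 0)) $$ (k,l))"
    using kl ij by (simp add: ampl_index linear_map_on_index[OF L block_carrier kl])
  also have "\<dots> = (\<Sum>p<d. \<Sum>q<d. of_nat d * (W $$ (i*d+p, j*d+q) * ampl d d L (max_ent d) $$ (p*d+k, q*d+l)))"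
    using kl by (intro sum.cong refl) (simp add: choi)
  finally show ?thesis by (simp only: sum_distrib_left)
qed

text \<open>In the Choi expansion, taking adjoints conjugates and transposes both \<open>W\<close>
  and the Choi matrix. If the latter is Hermitian, only \<open>W\<close> is affected.\<close>

lemma ampl_adj:
  assumes L: "linear_map_on d L" and h: "adj (ampl d d L (max_ent d)) = ampl d d L (max_ent d)"
    and W: "W \<in> carrier_mat (n*d) (n*d)"
  shows "ampl n d L (adj W) = adj (ampl n d L W)"
proof (rule block_eqI[of _ n d])
  let ?C = "ampl d d L (max_ent d)"
  fix i j k l assume ij: "i < n" "j < n" and kl: "k < d" "l < d"
  have C: "?C $$ (p*d+k, q*d+l) = cnj (?C $$ (q*d+l, p*d+k))" if "p < d" "q < d" for p q
    using adj_index[of "p*d+k" ?C "q*d+l"] block_index_less[OF that(1) kl(1)] block_index_less[OF that(2) kl(2)]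
    unfolding h by simp
  have aW: "adj W $$ (i*d+p, j*d+q) = cnj (W $$ (j*d+q, i*d+p))" if "p < d" "q < d" for p q
    using W block_index_less[OF ij(1) that(1)] block_index_less[OF ij(2) that(2)] by simp
  have "ampl n d L (adj W) $$ (i*d+k, j*d+l)
    = of_nat d * (\<Sum>p<d. \<Sum>q<d. cnj (W $$ (j*d+q, i*d+p) * ?C $$ (q*d+l, p*d+k)))"
    unfolding ampl_choi_index[OF L ij kl]
    by (intro arg_cong2[of _ _ _ _ "(*)"] sum.cong refl) (simp add: aW C[symmetric])
  also have "\<dots> = cnj (of_nat d * (\<Sum>q<d. \<Sum>p<d. W $$ (j*d+q, i*d+p) * ?C $$ (q*d+l, p*d+k)))"
    by (subst sum.swap) simp
  also have "\<dots> = cnj (ampl n d L W $$ (j*d+l, i*d+k))"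
    unfolding ampl_choi_index[OF L ij(2,1) kl(2,1)] ..
  also have "\<dots> = adj (ampl n d L W) $$ (i*d+k, j*d+l)"
    using block_index_less[OF ij(1) kl(1)] block_index_less[OF ij(2) kl(2)] by simp
  finally show "ampl n d L (adj W) $$ (i*d+k, j*d+l) = adj (ampl n d L W) $$ (i*d+k, j*d+l)" .
qed simp_all

text \<open>Factoring the Choi matrix as \<open>S S\<^sup>*\<close> turns the quadratic form of the amplified map into a sum
  of quadratic forms of \<open>W\<close>; this is the Kraus decomposition of the map.\<close>

lemma kraus_sum:
  fixes x :: "nat \<Rightarrow> complex" and d n m :: nat
  shows "(\<Sum>i<n. \<Sum>k<d. \<Sum>j<n. \<Sum>l<d. cnj (x (i*d+k)) * (c * (\<Sum>p<d. \<Sum>q<d. W (i*d+p, j*d+q)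
          * (\<Sum>r<m. S (p*d+k, r) * cnj (S (q*d+l, r))))) * x (j*d+l))
    = (\<Sum>r<m. c * (\<Sum>i<n. \<Sum>p<d. \<Sum>j<n. \<Sum>q<d.
        cnj (\<Sum>l<d. cnj (S (p*d+l, r)) * x (i*d+l)) * W (i*d+p, j*d+q) * (\<Sum>l<d. cnj (S (q*d+l, r)) * x (j*d+l))))"
    (is "?lhs = ?rhs")
proof -
  let ?t = "\<lambda>i k j l p q r. c * (S (p*d+k, r) * cnj (x (i*d+k)) * W (i*d+p, j*d+q)
        * (cnj (S (q*d+l, r)) * x (j*d+l)))"
  have "?lhs = (\<Sum>i<n. \<Sum>k<d. \<Sum>j<n. \<Sum>l<d. \<Sum>p<d. \<Sum>q<d. \<Sum>r<m. ?t i k j l p q r)"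
    by (intro sum.cong refl) (simp add: sum_distrib_left sum_distrib_right mult_ac)
  also have "\<dots> = (\<Sum>(i,k,j,l,p,q,r) \<in> {..<n} \<times> {..<d} \<times> {..<n} \<times> {..<d} \<times> {..<d} \<times> {..<d} \<times> {..<m}. ?t i k j l p q r)"
    by (simp only: sum.cartesian_product split_def fst_conv snd_conv)
  also have "\<dots> = (\<Sum>(r,i,p,j,q,l,k) \<in> {..<m} \<times> {..<n} \<times> {..<d} \<times> {..<n} \<times> {..<d} \<times> {..<d} \<times> {..<d}. ?t i k j l p q r)"
    by (rule sum.reindex_bij_witness[of _ "\<lambda>(r,i,p,j,q,l,k). (i,k,j,l,p,q,r)" "\<lambda>(i,k,j,l,p,q,r). (r,i,p,j,q,l,k)"]) auto
  also have "\<dots> = (\<Sum>r<m. \<Sum>i<n. \<Sum>p<d. \<Sum>j<n. \<Sum>q<d. \<Sum>l<d. \<Sum>k<d. ?t i k j l p q r)"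
    by (simp only: sum.cartesian_product split_def fst_conv snd_conv)
  also have "\<dots> = ?rhs"
    unfolding sum_distrib_left[of c]
    by (intro sum.cong refl) (simp add: sum_distrib_left sum_distrib_right)
  finally show ?thesis .
qed

text \<open>One half of Choi's theorem. Each column of the root \<open>S\<close> of the scaled Choi
  matrix, reshaped to a square, is a Kraus operator up to a scalar, and \<open>kraus_sum\<close>
  moves these operators from the map onto the test vector.\<close>

theorem completely_positive_if_psd_choi:
  assumes L: "linear_map_on d L" and psd: "psd (ampl d d L (max_ent d))"
  shows "completely_positive d L"
  unfolding completely_positive_def
proof (intro allI ballI impI)
  fix n W assume W: "W \<in> carrier_mat (n*d) (n*d)" "psd W"
  let ?C = "ampl d d L (max_ent d)"
  let ?Y = "ampl n d L W"
  obtain S where S: "S \<in> carrier_mat (d*d) (d*d)" "psd S" "S * S = ?C"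
    using psd_sqrt_exists[OF ampl_carrier psd] by blast
  have C: "?C $$ (a,b) = (\<Sum>r<d*d. S $$ (a,r) * cnj (S $$ (b,r)))" if ab: "a < d*d" "b < d*d" for a b
  proof -
    have "S $$ (r,b) = cnj (S $$ (b,r))" if "r < d*d" for r
      using adj_index[of r S b] S ab that unfolding psdD_hermitian[OF S(2)] by simp
    then show ?thesis
      unfolding S(3)[symmetric] index_mult_mat_sum[OF S(1) S(1) ab] by simp
  qed
  have Y: "?Y $$ (i*d+k, j*d+l) = of_nat d * (\<Sum>p<d. \<Sum>q<d. W $$ (i*d+p, j*d+q)
      * (\<Sum>r<d*d. S $$ (p*d+k, r) * cnj (S $$ (q*d+l, r))))"
    if "i < n" "j < n" "k < d" "l < d" for i j k l
    unfolding ampl_choi_index[OF L that]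
    using that by (intro arg_cong2[of _ _ _ _ "(*)"] sum.cong refl) (simp add: C block_index_less)
  have "adj ?Y = ?Y"
    using ampl_adj[OF L psdD_hermitian[OF psd] W(1)] psdD_hermitian[OF W(2)] by simp
  moreover have "0 \<le> Re (\<Sum>a<n*d. \<Sum>b<n*d. cnj (x a) * ?Y $$ (a,b) * x b)" for x
  proof -
    \<comment> \<open>\<open>y r\<close> is the test vector after the adjoint of Kraus operator
      \<open>r\<close> has acted on the second tensor factor.\<close>
    define y where "y r a = (\<Sum>l<d. cnj (S $$ ((a mod d)*d+l, r)) * x ((a div d)*d+l))" for r a
    have y: "y r (i*d+p) = (\<Sum>l<d. cnj (S $$ (p*d+l, r)) * x (i*d+l))" if "p < d" for r i p
      using that by (simp add: y_def)
    have "(\<Sum>a<n*d. \<Sum>b<n*d. cnj (x a) * ?Y $$ (a,b) * x b)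
      = (\<Sum>i<n. \<Sum>k<d. \<Sum>j<n. \<Sum>l<d. cnj (x (i*d+k)) * (of_nat d * (\<Sum>p<d. \<Sum>q<d. W $$ (i*d+p, j*d+q)
          * (\<Sum>r<d*d. S $$ (p*d+k, r) * cnj (S $$ (q*d+l, r))))) * x (j*d+l))"
      unfolding sum_lessThan_mult[of _ n d]
      by (intro sum.cong refl) (simp add: Y)
    also have "\<dots> = (\<Sum>r<d*d. of_nat d * (\<Sum>i<n. \<Sum>p<d. \<Sum>j<n. \<Sum>q<d.
        cnj (\<Sum>l<d. cnj (S $$ (p*d+l, r)) * x (i*d+l)) * W $$ (i*d+p, j*d+q) * (\<Sum>l<d. cnj (S $$ (q*d+l, r)) * x (j*d+l))))"
      by (rule kraus_sum)
    also have "\<dots> = (\<Sum>r<d*d. of_nat d * (\<Sum>a<n*d. \<Sum>b<n*d. cnj (y r a) * W $$ (a,b) * y r b))"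
      unfolding sum_lessThan_mult[of _ n d] by (simp add: y del: cnj_sum)
    finally have "Re (\<Sum>a<n*d. \<Sum>b<n*d. cnj (x a) * ?Y $$ (a,b) * x b)
      = (\<Sum>r<d*d. real d * Re (\<Sum>a<n*d. \<Sum>b<n*d. cnj (y r a) * W $$ (a,b) * y r b))"
      by (simp only: Re_sum) simp
    moreover have "0 \<le> \<dots>"
      using W(2)[unfolded psd_iff[OF W(1)]] by (intro sum_nonneg mult_nonneg_nonneg) (auto simp del: Re_sum)
    ultimately show ?thesis by simp
  qed
  ultimately show "psd ?Y" using psd_iff[OF ampl_carrier] by blast
qed

section \<open>Diamond norm and propagators\<close>

text \<open>The common end of both converse directions: trace preservation makes the trace of the
  image 1, so the bound says that its trace norm is at most its trace, which forces positivity of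
  the Choi matrix.\<close>

lemma completely_positive_if_trace_norm_le:
  assumes d: "d > 0" and L: "linear_map_on d L" and tp: "trace_preserving d L"
    and le: "trace_norm (ampl d d L (max_ent d)) \<le> 1"
  shows "completely_positive d L"
proof -
  have "\<And>A. A \<in> carrier_mat d d \<Longrightarrow> L A \<in> carrier_mat d d"
    using L by (auto simp: linear_map_on_def)
  then have "mtrace (ampl d d L (max_ent d)) = 1"
    using mtrace_ampl[OF tp _ max_ent_carrier] mtrace_max_ent[OF d] by simp
  then have "psd (ampl d d L (max_ent d))"
    using psd_if_trace_norm_le[OF ampl_carrier, of d d L "max_ent d"] le by simp
  then show ?thesis by (rule completely_positive_if_psd_choi[OF L])
qed

text \<open>A real \<open>Sup\<close> is an upper bound only for a set that is bounded above, so
  boundedness comes first. Entries of a matrix of trace norm 1 have modulus at most 1, and the Choi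
  expansion then bounds all entries of its image uniformly.\<close>

lemma trace_norm_ampl_le_diamond_norm:
  assumes L: "linear_map_on d L" and W: "W \<in> carrier_mat (d*d) (d*d)" "trace_norm W = 1"
  shows "trace_norm (ampl d d L W) \<le> diamond_norm d L"
proof -
  let ?C = "ampl d d L (max_ent d)"
  \<comment> \<open>Bound for entry \<open>(b,a)\<close> of the image: once the entries of the
    argument are estimated by 1, only the inner indices \<open>b mod d\<close> and
    \<open>a mod d\<close> remain.\<close>
  let ?k = "\<lambda>a b. real d * (\<Sum>p<d. \<Sum>q<d. cmod (?C $$ (p*d + b mod d, q*d + a mod d)))"
  let ?K = "\<Sum>a<d*d. \<Sum>b<d*d. ?k a b"
  have "trace_norm (ampl d d L V) \<le> ?K" if V: "V \<in> carrier_mat (d*d) (d*d)" "trace_norm V = 1" for V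
  proof -
    have "cmod (ampl d d L V $$ (b,a)) \<le> ?k a b" if a: "a < d*d" and b: "b < d*d" for a b
    proof -
      obtain i k where i: "i < d" "k < d" "b = i*d+k" using b by (rule block_index_cases)
      obtain j l where j: "j < d" "l < d" "a = j*d+l" using a by (rule block_index_cases)
      have "cmod (ampl d d L V $$ (b,a))
        = real d * cmod (\<Sum>p<d. \<Sum>q<d. V $$ (i*d+p, j*d+q) * ?C $$ (p*d+k, q*d+l))"
        unfolding i(3) j(3) ampl_choi_index[OF L i(1) j(1) i(2) j(2), of V] by (simp add: norm_mult)
      also have "\<dots> \<le> real d * (\<Sum>p<d. \<Sum>q<d. cmod (V $$ (i*d+p, j*d+q) * ?C $$ (p*d+k, q*d+l)))"
        by (intro mult_left_mono sum_norm_le norm_sum) simp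
      also have "\<dots> \<le> real d * (\<Sum>p<d. \<Sum>q<d. cmod (?C $$ (p*d+k, q*d+l)))"
      proof (intro mult_left_mono sum_mono)
        fix p q assume "p \<in> {..<d}" "q \<in> {..<d}"
        then have "cmod (V $$ (i*d+p, j*d+q)) \<le> 1"
          using entry_le_trace_norm[OF V(1)] V(2) i j by (simp add: block_index_less)
        then show "cmod (V $$ (i*d+p, j*d+q) * ?C $$ (p*d+k, q*d+l)) \<le> cmod (?C $$ (p*d+k, q*d+l))"
          by (simp add: norm_mult mult_left_le_one_le)
      qed simp
      finally show ?thesis using i j by simp
    qed
    then have "(\<Sum>a<d*d. \<Sum>b<d*d. cmod (ampl d d L V $$ (b,a))) \<le> ?K"
      by (intro sum_mono) simp
    then show ?thesis using trace_norm_le_sum_entries[OF ampl_carrier, of d d L V] by linarith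
  qed
  then have "bdd_above {trace_norm (ampl d d L W) | W. W \<in> carrier_mat (d*d) (d*d) \<and> trace_norm W = 1}"
    by (intro bdd_aboveI[of _ ?K]) blast
  then show ?thesis unfolding diamond_norm_def using W by (intro cSup_upper) auto
qed

text \<open>The supremum is attained at \<open>max_ent\<close>, whose image is positive of trace 1;
  contraction bounds all other values.\<close>

lemma diamond_norm_cptp:
  assumes d: "d > 0" and L: "cptp d L"
  shows "diamond_norm d L = 1"
  unfolding diamond_norm_def
proof (rule cSup_eq_maximum)
  have "\<And>A. A \<in> carrier_mat d d \<Longrightarrow> L A \<in> carrier_mat d d" and tp: "trace_preserving d L"
    using L by (auto simp: cptp_def linear_map_on_def)
  then have "mtrace (ampl d d L (max_ent d)) = 1"
    using mtrace_ampl[OF tp _ max_ent_carrier] mtrace_max_ent[OF d] by simp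
  moreover have "psd (ampl d d L (max_ent d))"
    using L psd_max_ent[of d] max_ent_carrier[of d] unfolding cptp_def completely_positive_def by blast
  ultimately have "trace_norm (ampl d d L (max_ent d)) = 1"
    by (simp add: trace_norm_psd[OF ampl_carrier])
  then show "1 \<in> {trace_norm (ampl d d L W) | W. W \<in> carrier_mat (d*d) (d*d) \<and> trace_norm W = 1}"
    using trace_norm_max_ent[OF d] max_ent_carrier[of d] by (intro CollectI exI[of _ "max_ent d"]) simp
next
  fix x assume "x \<in> {trace_norm (ampl d d L W) | W. W \<in> carrier_mat (d*d) (d*d) \<and> trace_norm W = 1}"
  then show "x \<le> 1" using cptp_trace_norm_contraction[OF L] by fastforce
qed

section \<open>Inverses and propagators\<close>

lemma linear_map_on_inv_into:
  assumes L: "linear_map_on d L" and bij: "bij_betw L (carrier_mat d d) (carrier_mat d d)"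
  shows "linear_map_on d (inv_into (carrier_mat d d) L)"
proof -
  let ?I = "inv_into (carrier_mat d d) L"
  have Ic: "?I A \<in> carrier_mat d d" if "A \<in> carrier_mat d d" for A
    using bij that by (metis bij_betw_imp_surj_on inv_into_into)
  have LI: "L (?I A) = A" if "A \<in> carrier_mat d d" for A
    using bij that by (metis bij_betw_imp_surj_on f_inv_into_f)
  have IL: "?I (L A) = A" if "A \<in> carrier_mat d d" for A
    using bij that by (metis bij_betw_imp_inj_on inv_into_f_f)
  have "?I (A + B) = ?I A + ?I B" if A: "A \<in> carrier_mat d d" and B: "B \<in> carrier_mat d d" for A B
  proof -
    have "L (?I A + ?I B) = A + B"
      using L Ic[OF A] Ic[OF B] LI[OF A] LI[OF B] unfolding linear_map_on_def by simp
    then show ?thesis using IL[OF add_carrier_mat[OF Ic[OF B], of "?I A"]] by simp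
  qed
  moreover have "?I (c \<cdot>\<^sub>m A) = c \<cdot>\<^sub>m ?I A" if A: "A \<in> carrier_mat d d" for c A
  proof -
    have "L (c \<cdot>\<^sub>m ?I A) = c \<cdot>\<^sub>m A"
      using L Ic[OF A] LI[OF A] unfolding linear_map_on_def by simp
    then show ?thesis using IL[OF smult_carrier_mat[OF Ic[OF A], of c]] by simp
  qed
  ultimately show ?thesis using Ic unfolding linear_map_on_def by blast
qed

lemma linear_map_on_comp:
  assumes "linear_map_on d L" "linear_map_on d V"
  shows "linear_map_on d (V \<circ> L)"
  using assms unfolding linear_map_on_def by simp

lemma trace_preserving_inv_into:
  assumes "trace_preserving d L" "bij_betw L (carrier_mat d d) (carrier_mat d d)"
  shows "trace_preserving d (inv_into (carrier_mat d d) L)"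
  using assms unfolding trace_preserving_def
  by (metis bij_betw_imp_surj_on f_inv_into_f inv_into_into)

context
  fixes d :: nat and \<Lambda> :: "real \<Rightarrow> complex mat \<Rightarrow> complex mat"
  assumes d: "d > 0" and dyn: "dynamical_map d \<Lambda>"
    and bij: "\<forall>t \<ge> 0. bij_betw (\<Lambda> t) (carrier_mat d d) (carrier_mat d d)"
begin

private abbreviation (input) "I s \<equiv> inv_into (carrier_mat d d) (\<Lambda> s)"

private lemma cptp_time: "0 \<le> t \<Longrightarrow> cptp d (\<Lambda> t)"
  using dyn by (auto simp: dynamical_map_def)

private lemma linear_time: "0 \<le> t \<Longrightarrow> linear_map_on d (\<Lambda> t)"
  using cptp_time by (auto simp: cptp_def)

private lemma linear_inv: "0 \<le> s \<Longrightarrow> linear_map_on d (I s)"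
  using linear_map_on_inv_into[OF linear_time] bij by blast

private lemma inv_apply: "0 \<le> s \<Longrightarrow> A \<in> carrier_mat d d \<Longrightarrow> \<Lambda> s (I s A) = A"
  using bij by (metis bij_betw_imp_surj_on f_inv_into_f)

private lemma apply_inv: "0 \<le> s \<Longrightarrow> A \<in> carrier_mat d d \<Longrightarrow> I s (\<Lambda> s A) = A"
  using bij by (metis bij_betw_imp_inj_on inv_into_f_f)

lemma linear_prop_map: "0 \<le> s \<Longrightarrow> s \<le> t \<Longrightarrow> linear_map_on d (prop_map d \<Lambda> t s)"
  unfolding prop_map_def by (intro linear_map_on_comp linear_inv linear_time) auto

lemma trace_preserving_prop_map:
  assumes "0 \<le> s" "s \<le> t"
  shows "trace_preserving d (prop_map d \<Lambda> t s)"
proof -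
  have "trace_preserving d (\<Lambda> t)" "trace_preserving d (I s)" "linear_map_on d (I s)"
    using assms cptp_time[of s] cptp_time[of t] bij trace_preserving_inv_into[of d "\<Lambda> s"] linear_inv[of s]
    by (auto simp: cptp_def)
  then show ?thesis unfolding trace_preserving_def prop_map_def linear_map_on_def by simp
qed

lemma cptp_prop_map_iff:
  "0 \<le> s \<Longrightarrow> s \<le> t \<Longrightarrow> cptp d (prop_map d \<Lambda> t s) \<longleftrightarrow> completely_positive d (prop_map d \<Lambda> t s)"
  using linear_prop_map trace_preserving_prop_map by (auto simp: cptp_def)

lemma completely_positive_prop_map_iff_diamond_norm:
  assumes "0 \<le> s" "s \<le> t"
  shows "completely_positive d (prop_map d \<Lambda> t s) \<longleftrightarrow> diamond_norm d (prop_map d \<Lambda> t s) = 1"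
proof
  assume "completely_positive d (prop_map d \<Lambda> t s)"
  then show "diamond_norm d (prop_map d \<Lambda> t s) = 1"
    using cptp_prop_map_iff[OF assms] diamond_norm_cptp[OF d] by blast
next
  assume "diamond_norm d (prop_map d \<Lambda> t s) = 1"
  then have "trace_norm (ampl d d (prop_map d \<Lambda> t s) (max_ent d)) \<le> 1"
    using trace_norm_ampl_le_diamond_norm[OF linear_prop_map[OF assms] max_ent_carrier trace_norm_max_ent[OF d]] by simp
  then show "completely_positive d (prop_map d \<Lambda> t s)"
    by (rule completely_positive_if_trace_norm_le[OF d linear_prop_map[OF assms] trace_preserving_prop_map[OF assms]])
qed

lemma completely_positive_prop_map_iff_contraction:
  assumes st: "0 \<le> s" "s \<le> t"
  shows "completely_positive d (prop_map d \<Lambda> t s) \<longleftrightarrow>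
    (\<forall>W \<in> carrier_mat (d*d) (d*d). hermitian_mat W \<longrightarrow>
      trace_norm (ampl d d (\<Lambda> t) W) \<le> trace_norm (ampl d d (\<Lambda> s) W))"
proof
  let ?V = "prop_map d \<Lambda> t s"
  have \<Lambda>c: "\<And>A. A \<in> carrier_mat d d \<Longrightarrow> \<Lambda> s A \<in> carrier_mat d d"
    and Ic: "\<And>A. A \<in> carrier_mat d d \<Longrightarrow> I s A \<in> carrier_mat d d"
    using linear_time[OF st(1)] linear_inv[OF st(1)] by (auto simp: linear_map_on_def)
  {
    assume "completely_positive d ?V"
    then have cptp: "cptp d ?V" using cptp_prop_map_iff[OF st] by simp
    have "ampl d d ?V (ampl d d (\<Lambda> s) W) = ampl d d (\<Lambda> t) W" for W
      using \<Lambda>c apply_inv[OF st(1)] by (intro ampl_ampl) (auto simp: prop_map_def)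
    then show "\<forall>W \<in> carrier_mat (d*d) (d*d). hermitian_mat W \<longrightarrow>
        trace_norm (ampl d d (\<Lambda> t) W) \<le> trace_norm (ampl d d (\<Lambda> s) W)"
      using cptp_trace_norm_contraction[OF cptp ampl_carrier] by metis
  }
  assume contr: "\<forall>W \<in> carrier_mat (d*d) (d*d). hermitian_mat W \<longrightarrow>
        trace_norm (ampl d d (\<Lambda> t) W) \<le> trace_norm (ampl d d (\<Lambda> s) W)"
  \<comment> \<open>Chosen so that at time \<open>s\<close> it has evolved into the maximally
    entangled state, of trace norm 1, and at time \<open>t\<close> into the scaled Choi matrix of
    the propagator.\<close>
  define W where "W = ampl d d (I s) (max_ent d)"
  have W: "W \<in> carrier_mat (d*d) (d*d)" by (simp add: W_def)
  have sW: "ampl d d (\<Lambda> s) W = max_ent d"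
    unfolding W_def using ampl_ampl[where L' = "\<lambda>A. A", OF Ic inv_apply[OF st(1)]] ampl_ident[OF max_ent_carrier] by simp
  have tW: "ampl d d (\<Lambda> t) W = ampl d d ?V (max_ent d)"
    unfolding W_def using Ic by (intro ampl_ampl) (auto simp: prop_map_def)
  have undo: "ampl d d (I s) (ampl d d (\<Lambda> s) X) = X" if "X \<in> carrier_mat (d*d) (d*d)" for X
    using ampl_ampl[where L' = "\<lambda>A. A", OF \<Lambda>c apply_inv[OF st(1)]] ampl_ident[OF that] by simp
  \<comment> \<open>The inverse map is not known to be positive, so Hermiticity is pulled back:
    \<open>adj W\<close> and \<open>W\<close> have the same image at time \<open>s\<close>, and
    amplification by the inverse separates them.\<close>
  have "adj W = W"
  proof -
    have "psd (ampl d d (\<Lambda> s) (max_ent d))"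
      using cptp_time[OF st(1)] psd_max_ent[of d] max_ent_carrier[of d]
      unfolding cptp_def completely_positive_def by blast
    from ampl_adj[OF linear_time[OF st(1)] psdD_hermitian[OF this] W]
    have "ampl d d (\<Lambda> s) (adj W) = ampl d d (\<Lambda> s) W"
      unfolding sW psdD_hermitian[OF psd_max_ent] .
    then show ?thesis using undo[OF W] undo[OF adj_carrier[OF W]] by metis
  qed
  then have "trace_norm (ampl d d ?V (max_ent d)) \<le> 1"
    using contr W hermitian_mat_iff[OF W] sW tW trace_norm_max_ent[OF d] by metis
  then show "completely_positive d ?V"
    by (rule completely_positive_if_trace_norm_le[OF d linear_prop_map[OF st] trace_preserving_prop_map[OF st]])
qed

end

theorem theorem3:
  fixes d :: nat and \<Lambda> :: "real \<Rightarrow> complex mat \<Rightarrow> complex mat"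
  assumes "d > 0"
    and "dynamical_map d \<Lambda>"
    and "\<forall>t \<ge> 0. bij_betw (\<Lambda> t) (carrier_mat d d) (carrier_mat d d)"
  shows "((\<forall>t s. 0 \<le> s \<and> s \<le> t \<longrightarrow> completely_positive d (prop_map d \<Lambda> t s))
          \<longleftrightarrow> (\<forall>t s. 0 \<le> s \<and> s \<le> t \<longrightarrow> diamond_norm d (prop_map d \<Lambda> t s) = 1))
       \<and> ((\<forall>t s. 0 \<le> s \<and> s \<le> t \<longrightarrow> diamond_norm d (prop_map d \<Lambda> t s) = 1)
          \<longleftrightarrow> (\<forall>W \<in> carrier_mat (d*d) (d*d). hermitian_mat W \<longrightarrow>
                 (\<forall>t s. 0 \<le> s \<and> s \<le> t \<longrightarrow>
                    trace_norm (ampl d d (\<Lambda> t) W) \<le> trace_norm (ampl d d (\<Lambda> s) W))))"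
  \<comment> \<open>Both equivalences hold for each pair of times and pass through complete
    positivity; composing them links the diamond norm with monotonicity.\<close>
  using completely_positive_prop_map_iff_diamond_norm[OF assms]
    completely_positive_prop_map_iff_contraction[OF assms] by blast

end
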